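(* Let $\Omega\subset\mathbb{R}^2$ be a bounded Lipschitz domain, $\epsilon\in(0,1]$, $\bm f=(f_1,f_2,f_3)\in (L^2(\Omega))^3$, and let $\bm u=(p,n,\psi)\in (H^1(\Omega))^3$ be a weak solution (with Dirichlet boundary conditions) of the steady-state Poisson-Nernst-Planck system, i.e. $\langle \bm F(\bm u),\bm v\rangle=0$ for all $\bm v\in (H_0^1(\Omega))^3$. If $p,n\in L^\infty(\Omega)$, $\psi\in W^{1,\infty}(\Omega)$, and $$\|\nabla\psi\|_{L^{\infty}(\Omega)}+\sqrt{2}\,C_p\,\epsilon^{-1}\max\{\|p\|_{L^{\infty}(\Omega)},\|n\|_{L^{\infty}(\Omega)}\}<\frac{\sqrt{2}}{1+C_p^2},$$ where the constant $C_p$ depends on $\Omega$ only, then for every $\bm R\in (L^2(\Omega))^3$ there exists a unique $\bm\phi=(\phi_1,\phi_2,\phi_3)\in (H_0^1(\Omega))^3$ such that $$\langle \bm{DF}(\bm u)\bm\phi,\bm v\rangle=\langle \bm R,\bm v\rangle\qquad\text{for all } \bm v\in (H_0^1(\Omega))^3 .$$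
   Context: The steady-state Poisson-Nernst-Planck system is $-\Delta p-\nabla\cdot(p\nabla\psi)=f_1$, $-\Delta n+\nabla\cdot(n\nabla\psi)=f_2$, $-\epsilon\Delta\psi=p-n+f_3$ in $\Omega$, with Dirichlet boundary conditions. The nonlinear operator $\bm F$ is defined, for $\bm u=(p,n,\psi)$ and $\bm v=(v_1,v_2,v_3)\in (H_0^1(\Omega))^3$, by $$\langle \bm F(\bm u),\bm v\rangle=\int_\Omega\big(\nabla p\cdot\nabla v_1+p\nabla\psi\cdot\nabla v_1+\nabla n\cdot\nabla v_2-n\nabla\psi\cdot\nabla v_2+\epsilon\nabla\psi\cdot\nabla v_3-pv_3+nv_3-f_1v_1-f_2v_2-f_3v_3\big)\,d\bm x .$$ $\bm{DF}(\bm u)$ is its Gâteaux derivative at $\bm u$: $$\langle \bm{DF}(\bm u)\bm\phi,\bm v\rangle=\int_\Omega\big(\nabla\phi_1\cdot\nabla v_1+p\nabla\phi_3\cdot\nabla v_1+\phi_1\nabla\psi\cdot\nabla v_1+\nabla\phi_2\cdot\nabla v_2-n\nabla\phi_3\cdot\nabla v_2-\phi_2\nabla\psi\cdot\nabla v_2+\epsilon\nabla\phi_3\cdot\nabla v_3-\phi_1v_3+\phi_2v_3\big)\,d\bm x .$$ $\langle\bm R,\bm v\rangle=\int_\Omega \bm R\cdot\bm v\,d\bm x$. The constant $C_p$, depending only on $\Omega$, is the Poincaré constant: $\|v\|_{L^2(\Omega)}\le C_p\|\nabla v\|_{L^2(\Omega)}$ for all $v\in H_0^1(\Omega)$; with the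 same constant, the weak solution $w\in H_0^1(\Omega)$ of $-\Delta w=g$ satisfies $\|\nabla w\|_{L^2(\Omega)}\le C_p\|g\|_{L^2(\Omega)}$ for $g\in L^2(\Omega)$. *)

theory Defs
  imports "HOL-Probability.Essential_Supremum"
begin

section \<open>Bounded Lipschitz domains\<close>

text \<open>
  Near every boundary point the set is the strict epigraph, in some direction \<open>e\<close>, of a
  Lipschitz function of the coordinates orthogonal to \<open>e\<close>.
\<close>

definition bounded_lipschitz_domain :: "'a::euclidean_space set \<Rightarrow> bool" where
  "bounded_lipschitz_domain \<Omega> \<longleftrightarrow>
     open \<Omega> \<and> connected \<Omega> \<and> \<Omega> \<noteq> {} \<and> bounded \<Omega> \<and>
     (\<forall>z\<in>frontier \<Omega>. \<exists>r>0. \<exists>e L. \<exists>\<gamma>::'a \<Rightarrow> real.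
        norm e = 1 \<and> L-lipschitz_on {y. y \<bullet> e = 0} \<gamma> \<and>
        \<Omega> \<inter> ball z r = {x \<in> ball z r. x \<bullet> e > \<gamma> (x - (x \<bullet> e) *\<^sub>R e)})"


section \<open>Lebesgue spaces\<close>

text \<open>
  Elements of function spaces are functions on the whole space, of which only the restriction
  to \<open>\<Omega>\<close>, up to null sets, is relevant. Equality in these spaces is equality almost
  everywhere on \<open>\<Omega>\<close>.
\<close>

definition L2_space :: "'a::euclidean_space set \<Rightarrow> ('a \<Rightarrow> 'b::euclidean_space) set" where
  "L2_space \<Omega> = {f \<in> borel_measurable (lebesgue_on \<Omega>).
     integrable (lebesgue_on \<Omega>) (\<lambda>x. (norm (f x))\<^sup>2)}"

definition L2_norm :: "'a::euclidean_space set \<Rightarrow> ('a \<Rightarrow> 'b::euclidean_space) \<Rightarrow> real" where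
  "L2_norm \<Omega> f = sqrt (LINT x|lebesgue_on \<Omega>. (norm (f x))\<^sup>2)"

definition Linf_space :: "'a::euclidean_space set \<Rightarrow> ('a \<Rightarrow> 'b::euclidean_space) set" where
  "Linf_space \<Omega> = {f \<in> borel_measurable (lebesgue_on \<Omega>).
     esssup (lebesgue_on \<Omega>) (\<lambda>x. ereal (norm (f x))) < \<infinity>}"

definition Linf_norm :: "'a::euclidean_space set \<Rightarrow> ('a \<Rightarrow> 'b::euclidean_space) \<Rightarrow> real" where
  "Linf_norm \<Omega> f = real_of_ereal (esssup (lebesgue_on \<Omega>) (\<lambda>x. ereal (norm (f x))))"

definition locally_integrable_on ::
    "('a::euclidean_space \<Rightarrow> 'b::euclidean_space) \<Rightarrow> 'a set \<Rightarrow> bool" where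
  "locally_integrable_on f \<Omega> \<longleftrightarrow>
     (\<forall>K. compact K \<and> K \<subseteq> \<Omega> \<longrightarrow> set_integrable lebesgue K f)"


section \<open>Test functions and weak gradients\<close>

primrec C_k :: "nat \<Rightarrow> ('a::euclidean_space \<Rightarrow> real) \<Rightarrow> bool" where
  "C_k 0 f \<longleftrightarrow> continuous_on UNIV f"
| "C_k (Suc k) f \<longleftrightarrow> (\<forall>x. f differentiable (at x)) \<and>
     (\<forall>i\<in>Basis. C_k k (\<lambda>x. frechet_derivative f (at x) i))"

definition test_functions :: "'a::euclidean_space set \<Rightarrow> ('a \<Rightarrow> real) set" where
  "test_functions \<Omega> = {\<phi>. (\<forall>k. C_k k \<phi>) \<and>
     compact (closure {x. \<phi> x \<noteq> 0}) \<and> closure {x. \<phi> x \<noteq> 0} \<subseteq> \<Omega>}"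

definition has_weak_grad ::
    "'a::euclidean_space set \<Rightarrow> ('a \<Rightarrow> real) \<Rightarrow> ('a \<Rightarrow> 'a) \<Rightarrow> bool" where
  "has_weak_grad \<Omega> u G \<longleftrightarrow>
     locally_integrable_on u \<Omega> \<and> locally_integrable_on G \<Omega> \<and>
     (\<forall>\<phi>\<in>test_functions \<Omega>. \<forall>i\<in>Basis.
        (LINT x|lebesgue_on \<Omega>. u x * frechet_derivative \<phi> (at x) i) =
        - (LINT x|lebesgue_on \<Omega>. (G x \<bullet> i) * \<phi> x))"

text \<open>
  A weak gradient on an open set is unique only up to null sets, so \<open>wgrad\<close> picks an
  arbitrary representative.
\<close>

definition wgrad :: "'a::euclidean_space set \<Rightarrow> ('a \<Rightarrow> real) \<Rightarrow> 'a \<Rightarrow> 'a" where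
  "wgrad \<Omega> u = (SOME G. has_weak_grad \<Omega> u G)"


section \<open>Sobolev spaces\<close>

definition H1 :: "'a::euclidean_space set \<Rightarrow> ('a \<Rightarrow> real) set" where
  "H1 \<Omega> = {u \<in> L2_space \<Omega>. \<exists>G\<in>L2_space \<Omega>. has_weak_grad \<Omega> u G}"

definition W1inf :: "'a::euclidean_space set \<Rightarrow> ('a \<Rightarrow> real) set" where
  "W1inf \<Omega> = {u \<in> Linf_space \<Omega>. \<exists>G\<in>Linf_space \<Omega>. has_weak_grad \<Omega> u G}"

definition H1_norm :: "'a::euclidean_space set \<Rightarrow> ('a \<Rightarrow> real) \<Rightarrow> real" where
  "H1_norm \<Omega> u = sqrt ((L2_norm \<Omega> u)\<^sup>2 + (L2_norm \<Omega> (wgrad \<Omega> u))\<^sup>2)"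

text \<open>The closure of the test functions in the \<open>H1\<close> norm.\<close>

definition H10 :: "'a::euclidean_space set \<Rightarrow> ('a \<Rightarrow> real) set" where
  "H10 \<Omega> = {u \<in> H1 \<Omega>. \<forall>e>0. \<exists>\<phi>\<in>test_functions \<Omega>. H1_norm \<Omega> (\<lambda>x. u x - \<phi> x) < e}"

text \<open>
  The constant is not required to be optimal. Testing \<open>- \<Delta> w = g\<close> with \<open>w\<close> shows that the
  bound of the gradient of \<open>w\<close> by \<open>g\<close> in the \<open>L2\<close> norms holds with the same constant.
\<close>

definition poincare_constant :: "'a::euclidean_space set \<Rightarrow> real \<Rightarrow> bool" where
  "poincare_constant \<Omega> C \<longleftrightarrow> (\<forall>v\<in>H10 \<Omega>. L2_norm \<Omega> v \<le> C * L2_norm \<Omega> (wgrad \<Omega> v))"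


section \<open>The steady-state Poisson--Nernst--Planck system\<close>

type_synonym 'a fun3 = "('a \<Rightarrow> real) \<times> ('a \<Rightarrow> real) \<times> ('a \<Rightarrow> real)"

abbreviation cube :: "'b set \<Rightarrow> ('b \<times> 'b \<times> 'b) set" where
  "cube V \<equiv> V \<times> V \<times> V"

fun PNP_F :: "'a::euclidean_space set \<Rightarrow> real \<Rightarrow> 'a fun3 \<Rightarrow> 'a fun3 \<Rightarrow> 'a fun3 \<Rightarrow> real" where
  "PNP_F \<Omega> \<epsilon> (f1, f2, f3) (p, n, \<psi>) (v1, v2, v3) =
     (LINT x|lebesgue_on \<Omega>.
          wgrad \<Omega> p x \<bullet> wgrad \<Omega> v1 x + p x * (wgrad \<Omega> \<psi> x \<bullet> wgrad \<Omega> v1 x)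
        + wgrad \<Omega> n x \<bullet> wgrad \<Omega> v2 x - n x * (wgrad \<Omega> \<psi> x \<bullet> wgrad \<Omega> v2 x)
        + \<epsilon> * (wgrad \<Omega> \<psi> x \<bullet> wgrad \<Omega> v3 x) - p x * v3 x + n x * v3 x
        - f1 x * v1 x - f2 x * v2 x - f3 x * v3 x)"

text \<open>The Gateaux derivative of \<open>PNP_F\<close> with respect to \<open>(p, n, \<psi>)\<close> in direction \<open>(\<phi>1, \<phi>2, \<phi>3)\<close>.\<close>

fun PNP_DF :: "'a::euclidean_space set \<Rightarrow> real \<Rightarrow> 'a fun3 \<Rightarrow> 'a fun3 \<Rightarrow> 'a fun3 \<Rightarrow> real" where
  "PNP_DF \<Omega> \<epsilon> (p, n, \<psi>) (\<phi>1, \<phi>2, \<phi>3) (v1, v2, v3) =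
     (LINT x|lebesgue_on \<Omega>.
          wgrad \<Omega> \<phi>1 x \<bullet> wgrad \<Omega> v1 x + p x * (wgrad \<Omega> \<phi>3 x \<bullet> wgrad \<Omega> v1 x)
        + \<phi>1 x * (wgrad \<Omega> \<psi> x \<bullet> wgrad \<Omega> v1 x)
        + wgrad \<Omega> \<phi>2 x \<bullet> wgrad \<Omega> v2 x - n x * (wgrad \<Omega> \<phi>3 x \<bullet> wgrad \<Omega> v2 x)
        - \<phi>2 x * (wgrad \<Omega> \<psi> x \<bullet> wgrad \<Omega> v2 x)
        + \<epsilon> * (wgrad \<Omega> \<phi>3 x \<bullet> wgrad \<Omega> v3 x) - \<phi>1 x * v3 x + \<phi>2 x * v3 x)"

fun L2_pairing :: "'a::euclidean_space set \<Rightarrow> 'a fun3 \<Rightarrow> 'a fun3 \<Rightarrow> real" where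
  "L2_pairing \<Omega> (R1, R2, R3) (v1, v2, v3) =
     (LINT x|lebesgue_on \<Omega>. R1 x * v1 x + R2 x * v2 x + R3 x * v3 x)"

fun AE_equal3 :: "'a::euclidean_space set \<Rightarrow> 'a fun3 \<Rightarrow> 'a fun3 \<Rightarrow> bool" where
  "AE_equal3 \<Omega> (a1, a2, a3) (b1, b2, b3) \<longleftrightarrow>
     (AE x in lebesgue_on \<Omega>. a1 x = b1 x \<and> a2 x = b2 x \<and> a3 x = b3 x)"

text \<open>
  The Dirichlet condition is stated through an \<open>H1\<close> extension \<open>(g1, g2, g3)\<close> of the boundary data:
  the two triples have the same trace iff their difference lies in \<open>H10\<close>.
\<close>

fun PNP_weak_solution ::
    "'a::euclidean_space set \<Rightarrow> real \<Rightarrow> 'a fun3 \<Rightarrow> 'a fun3 \<Rightarrow> 'a fun3 \<Rightarrow> bool" where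
  "PNP_weak_solution \<Omega> \<epsilon> f (g1, g2, g3) (p, n, \<psi>) \<longleftrightarrow>
     (p, n, \<psi>) \<in> cube (H1 \<Omega>) \<and>
     (\<lambda>x. p x - g1 x, \<lambda>x. n x - g2 x, \<lambda>x. \<psi> x - g3 x) \<in> cube (H10 \<Omega>) \<and>
     (\<forall>v\<in>cube (H10 \<Omega>). PNP_F \<Omega> \<epsilon> f (p, n, \<psi>) v = 0)"

end

theory Submission
  imports Defs
begin

text \<open>
  The linearised problem is solved by the Lax--Milgram theorem in the Hilbert space of triples of
  pairs \<open>(u, \<nabla>u)\<close> with \<open>u\<close> in \<open>H10\<close>. The form itself need not be coercive, but it becomes so when
  the third test function is multiplied by a constant \<open>\<mu>\<close>: with \<open>K\<close> the bound of the gradient of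
  \<open>\<psi>\<close>, \<open>M\<close> that of \<open>p\<close> and \<open>n\<close>, and \<open>C\<close> the Poincare constant, the choice \<open>\<mu> = M / C\<^sup>2\<close> works as soon as
  \<open>K C + 2 M C\<^sup>2 / \<epsilon> < 1\<close>, and the hypothesis implies this because \<open>2 C \<le> 1 + C\<^sup>2\<close>.

  The pairs \<open>(u, \<nabla>u)\<close> form a closed subspace of a product of \<open>L2\<close> spaces because the defining
  identity of the weak gradient is an orthogonality relation there. Since \<open>wgrad\<close> is a choice, this
  also needs the uniqueness of weak gradients up to null sets and the integration by parts for test
  functions.
\<close>

section \<open>The Lax--Milgram theorem\<close>

text \<open>Unscaled, the mixed terms carry the weight \<open>M + C^2\<close> against the diagonal
  entry \<epsilon> of the third equation. The hypothesis keeps M small against \<epsilon> but says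
  nothing of this kind about \<open>C^2\<close>, and \<epsilon> may be tiny. With the factor \<mu>
  the weight becomes \<open>M + \<mu> * C^2\<close>, the diagonal entry
  \<open>\<mu> * \<epsilon>\<close>, and positivity asks for
  \<open>(M + \<mu> * C^2)^2 < 2 * \<beta> * \<mu> * \<epsilon>\<close> with
  \<open>\<beta> = 1 - K * C\<close>. The best \<mu> minimises
  \<open>(M + \<mu> * C^2)^2 / \<mu>\<close>, that is \<open>\<mu> * C^2 = M\<close>, and leaves
  \<open>2 * M * C^2 < \<beta> * \<epsilon>\<close>. Changing the test function by a nonzero factor
  does not change the solutions. A type cannot depend on \<Omega>, so there is a single type of
  square integrable classes on the whole space, and \<Omega> enters through extension by zero.
  Keeping u and its gradient as a pair makes the product norm the H1 norm, so completeness only has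
  to be proved for L2.\<close>

lemma hilbert_projection:
  fixes W :: "'h::{real_inner,complete_space} set"
  assumes W: "subspace W" "closed W"
  shows "\<exists>y\<in>W. \<forall>v\<in>W. (x - y) \<bullet> v = 0"
proof -
  define d where "d = Inf ((\<lambda>w. (norm (x - w))\<^sup>2) ` W)"
  have bdd: "bdd_below ((\<lambda>w. (norm (x - w))\<^sup>2) ` W)"
    by (rule bdd_belowI[where m=0]) auto
  have ne: "W \<noteq> {}" using W(1) subspace_0 by blast
  have d_le: "d \<le> (norm (x - w))\<^sup>2" if "w \<in> W" for w
    unfolding d_def using bdd that by (intro cInf_lower) auto
  have "\<exists>w\<in>W. (norm (x - w))\<^sup>2 < d + 1 / real (Suc k)" for k
  proof -
    have "d < d + 1 / real (Suc k)" by simp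
    then show ?thesis unfolding d_def
      using cInf_less_iff[OF _ bdd, of "Inf ((\<lambda>w. (norm (x - w))\<^sup>2) ` W) + 1 / real (Suc k)"] ne by auto
  qed
  then obtain y where yW: "y k \<in> W" and yd: "(norm (x - y k))\<^sup>2 < d + 1 / real (Suc k)" for k
    by metis
  \<comment> \<open>The midpoint of \<open>y j\<close> and \<open>y k\<close> lies in W, so its
    squared distance from x is at least d. In the parallelogram law this makes the minimising
    sequence Cauchy.\<close>
  have close: "(norm (y j - y k))\<^sup>2 \<le> 2 * (1 / real (Suc j)) + 2 * (1 / real (Suc k))" for j k
  proof -
    have par: "(norm (y j - y k))\<^sup>2
        = 2 * (norm (x - y j))\<^sup>2 + 2 * (norm (x - y k))\<^sup>2 - 4 * (norm (x - (1/2) *\<^sub>R (y j + y k)))\<^sup>2"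
      by (simp add: power2_norm_eq_inner inner_diff inner_add inner_commute algebra_simps)
    have "(1/2) *\<^sub>R (y j + y k) \<in> W"
      using yW W(1) by (simp add: subspace_add subspace_mul)
    from d_le[OF this] show ?thesis
      using par yd[of j] yd[of k] by linarith
  qed
  have "Cauchy y"
  proof (rule metric_CauchyI)
    fix e :: real assume e: "e > 0"
    obtain N where N: "4 / e\<^sup>2 < real N" using reals_Archimedean2 by blast
    have "dist (y j) (y k) < e" if "j \<ge> N" "k \<ge> N" for j k
    proof -
      have Np: "real N > 0" using N e by (smt (verit) divide_pos_pos zero_less_power)
      have "2 / real (Suc j) \<le> 2 / real N" "2 / real (Suc k) \<le> 2 / real N"
        using that Np by (auto intro!: divide_left_mono mult_pos_pos)
      then have "(norm (y j - y k))\<^sup>2 \<le> 4 / real N" using close[of j k] by simp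
      also have "\<dots> < e\<^sup>2" using N Np e by (simp add: field_simps)
      finally show ?thesis using e by (simp add: dist_norm power2_less_imp_less)
    qed
    then show "\<exists>M. \<forall>m\<ge>M. \<forall>n\<ge>M. dist (y m) (y n) < e" by blast
  qed
  then obtain z where z: "y \<longlonglongrightarrow> z" using Cauchy_convergent convergent_def by blast
  have zW: "z \<in> W" using closed_sequentially[OF W(2)] yW z by blast
  have "(\<lambda>k. (norm (x - y k))\<^sup>2) \<longlonglongrightarrow> (norm (x - z))\<^sup>2"
    by (intro tendsto_intros z)
  moreover have "(\<lambda>k. d + 1 / real (Suc k)) \<longlonglongrightarrow> d + 0"
    using LIMSEQ_inverse_real_of_nat by (intro tendsto_intros) (simp add: inverse_eq_divide)
  ultimately have zd: "(norm (x - z))\<^sup>2 \<le> d"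
    using yd by (intro LIMSEQ_le[of _ "(norm (x - z))\<^sup>2" _ d]) (auto intro: less_imp_le)
  have "(x - z) \<bullet> v = 0" if v: "v \<in> W" for v
  proof (cases "v = 0")
    case False
    \<comment> \<open>This t minimises \<open>norm ((x - z) - t *\<^sub>R v)\<close>. As z is
      already a minimiser, the gain \<open>((x - z) \<bullet> v)^2 / (v \<bullet> v)\<close> must
      vanish.\<close>
    define t where "t = ((x - z) \<bullet> v) / (v \<bullet> v)"
    have vv: "v \<bullet> v > 0" using False by simp
    have "z + t *\<^sub>R v \<in> W" using zW v W(1) by (simp add: subspace_add subspace_mul)
    then have "(norm (x - z))\<^sup>2 \<le> (norm ((x - z) - t *\<^sub>R v))\<^sup>2"
      using d_le[of "z + t *\<^sub>R v"] zd by (metis diff_diff_eq order_trans)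
    then have "2 * t * ((x - z) \<bullet> v) \<le> t * t * (v \<bullet> v)"
      by (simp add: power2_norm_eq_inner inner_diff inner_commute algebra_simps)
    then have "((x - z) \<bullet> v)\<^sup>2 / (v \<bullet> v) \<le> 0"
      using vv by (simp add: t_def power2_eq_square field_simps)
    then have "((x - z) \<bullet> v)\<^sup>2 \<le> 0" using vv by (simp add: divide_le_0_iff)
    then show ?thesis by simp
  qed simp
  with zW show ?thesis by blast
qed

text \<open>The solution is the fixed point of a damped residual iteration on W. T may lead out of
  W, so the residual is first projected back by P, which leaves its inner products with elements of
  W unchanged.\<close>

theorem lax_milgram:
  fixes W :: "'h::{real_inner,complete_space} set" and T :: "'h \<Rightarrow> 'h"
  assumes W: "subspace W" "closed W" and T: "bounded_linear T"
    and c: "c > 0" "\<And>u. u \<in> W \<Longrightarrow> c * (norm u)\<^sup>2 \<le> T u \<bullet> u"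
  shows "\<exists>!u. u \<in> W \<and> (\<forall>v\<in>W. T u \<bullet> v = r \<bullet> v)"
proof -
  interpret T: bounded_linear T by (rule T)
  obtain P where PW: "P x \<in> W" and Po: "\<And>v. v \<in> W \<Longrightarrow> P x \<bullet> v = x \<bullet> v" for x
    using hilbert_projection[OF W] by (metis (no_types) eq_iff_diff_eq_0 inner_diff_left)
  have P_norm: "norm (P x) \<le> norm x" for x
  proof -
    have "norm (P x) * norm (P x) = x \<bullet> P x"
      using Po[OF PW] by (metis power2_eq_square power2_norm_eq_inner)
    also have "\<dots> \<le> norm x * norm (P x)" by (rule norm_cauchy_schwarz)
    finally show ?thesis by (cases "P x = 0") auto
  qed
  have P_eq: "a = b" if "a \<in> W" "b \<in> W" "\<And>v. v \<in> W \<Longrightarrow> a \<bullet> v = b \<bullet> v" for a b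
  proof -
    have "a - b \<in> W" using that W(1) subspace_diff by blast
    then have "(a - b) \<bullet> (a - b) = 0" using that(3) by (simp add: inner_diff_left)
    then show ?thesis by simp
  qed
  have P_diff: "P x - P y = P (x - y)" for x y
    by (rule P_eq) (auto simp: PW Po inner_diff_left subspace_diff[OF W(1)])
  obtain K where K: "K > 0" "\<And>u. norm (T u) \<le> norm u * K" using T.pos_bounded by blast
  \<comment> \<open>Adding c to the operator bound forces \<open>c < M\<close>, so that the
    contraction factor below is the root of a positive number.\<close>
  define M where "M = K + c"
  have M: "M > 0" "c < M" "norm (T u) \<le> M * norm u" for u
    using K c(1) add_mono[OF K(2)[of u], of 0 "c * norm u"] by (auto simp: M_def algebra_simps)
  \<comment> \<open>This step length minimises \<open>1 - 2 * \<rho> * c + \<rho>^2 * M^2\<close>,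
    the bound for the squared contraction factor; the minimum is
    \<open>1 - c^2 / M^2\<close>.\<close>
  define \<rho> where "\<rho> = c / M\<^sup>2"
  have \<rho>: "\<rho> > 0" using c(1) M(1) by (simp add: \<rho>_def)
  define S where "S u = u - \<rho> *\<^sub>R P (T u - r)" for u
  define q where "q = sqrt (1 - c\<^sup>2 / M\<^sup>2)"
  have cM: "c\<^sup>2 / M\<^sup>2 < 1" "c\<^sup>2 / M\<^sup>2 > 0"
    using c(1) M(1,2) by (auto simp: power_strict_mono)
  have q: "0 \<le> q" "q < 1" using cM by (auto simp: q_def)
  have contr: "dist (S u) (S v) \<le> q * dist u v" if "u \<in> W" "v \<in> W" for u v
  proof -
    define w where "w = u - v"
    have w: "w \<in> W" using that W(1) subspace_diff by (simp add: w_def)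
    have "S u - S v = w - \<rho> *\<^sub>R (P (T u - r) - P (T v - r))"
      by (simp add: S_def w_def algebra_simps)
    also have "\<dots> = w - \<rho> *\<^sub>R P (T w)"
      by (simp add: P_diff w_def T.diff)
    finally have S_diff: "S u - S v = w - \<rho> *\<^sub>R P (T w)" .
    have "(norm (S u - S v))\<^sup>2 = (norm w)\<^sup>2 - 2 * \<rho> * (P (T w) \<bullet> w) + \<rho>\<^sup>2 * (norm (P (T w)))\<^sup>2"
      unfolding S_diff power2_norm_eq_inner by (simp add: inner_diff inner_commute algebra_simps power2_eq_square)
    also have "\<dots> \<le> (norm w)\<^sup>2 - 2 * \<rho> * (c * (norm w)\<^sup>2) + \<rho>\<^sup>2 * (M * norm w)\<^sup>2"
    proof -
      have "c * (norm w)\<^sup>2 \<le> P (T w) \<bullet> w" using c(2)[OF w] Po[OF w] by simp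
      moreover have "norm (P (T w)) \<le> M * norm w" using P_norm M(3) order_trans by blast
      then have "(norm (P (T w)))\<^sup>2 \<le> (M * norm w)\<^sup>2" by (rule power_mono) simp
      ultimately show ?thesis using \<rho>
        by (smt (verit, ccfv_SIG) mult_left_mono zero_le_power2)
    qed
    also have "\<dots> = (1 - c\<^sup>2 / M\<^sup>2) * (norm w)\<^sup>2"
      using M(1) by (simp add: \<rho>_def field_simps power2_eq_square)
    also have "\<dots> = (q * norm w)\<^sup>2"
      using cM by (simp add: q_def power_mult_distrib)
    finally have "norm (S u - S v) \<le> q * norm w"
      by (rule power2_le_imp_le) (use q in simp)
    then show ?thesis by (simp add: dist_norm w_def)
  qed
  have SW: "S ` W \<subseteq> W"
    using W(1) PW by (auto simp: S_def intro!: subspace_diff subspace_mul)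
  have "complete W" using W(2) complete_eq_closed by blast
  moreover have "W \<noteq> {}" using subspace_0[OF W(1)] by blast
  ultimately have "\<exists>!u. u \<in> W \<and> S u = u"
    by (rule Banach_fix[OF _ _ q SW contr])
  moreover have "S u = u \<longleftrightarrow> (\<forall>v\<in>W. T u \<bullet> v = r \<bullet> v)" if "u \<in> W" for u
  proof -
    have "S u = u \<longleftrightarrow> P (T u - r) = 0" using \<rho> by (simp add: S_def)
    also have "\<dots> \<longleftrightarrow> (\<forall>v\<in>W. (T u - r) \<bullet> v = 0)"
      using P_eq[OF PW subspace_0[OF W(1)]] Po by (metis inner_zero_left)
    finally show ?thesis by (simp add: inner_diff_left)
  qed
  ultimately show ?thesis by metis
qed

section \<open>The Hilbert space of square integrable functions\<close>

lemma L2_spaceD: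
  assumes "f \<in> L2_space \<Omega>"
  shows "f \<in> borel_measurable (lebesgue_on \<Omega>)"
    and "integrable (lebesgue_on \<Omega>) (\<lambda>x. (norm (f x))\<^sup>2)"
  using assms by (auto simp: L2_space_def)

lemma L2_space_bound:
  assumes "g \<in> borel_measurable (lebesgue_on \<Omega>)" "f \<in> L2_space \<Omega>"
    and "AE x in lebesgue_on \<Omega>. norm (g x) \<le> K * norm (f x)"
  shows "g \<in> L2_space \<Omega>"
proof -
  have "integrable (lebesgue_on \<Omega>) (\<lambda>x. (norm (g x))\<^sup>2)"
  proof (rule Bochner_Integration.integrable_bound)
    show "integrable (lebesgue_on \<Omega>) (\<lambda>x. K\<^sup>2 * (norm (f x))\<^sup>2)"
      using L2_spaceD[OF assms(2)] by simp
    show "(\<lambda>x. (norm (g x))\<^sup>2) \<in> borel_measurable (lebesgue_on \<Omega>)"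
      using assms(1) by measurable
    show "AE x in lebesgue_on \<Omega>. norm ((norm (g x))\<^sup>2) \<le> norm (K\<^sup>2 * (norm (f x))\<^sup>2)"
      using assms(3)
    proof eventually_elim
      case (elim x)
      then have "(norm (g x))\<^sup>2 \<le> (K * norm (f x))\<^sup>2" by (intro power_mono) auto
      then show ?case by (simp add: power_mult_distrib)
    qed
  qed
  with assms(1) show ?thesis by (simp add: L2_space_def)
qed

lemma L2_space_scaleR: "f \<in> L2_space \<Omega> \<Longrightarrow> (\<lambda>x. c *\<^sub>R f x) \<in> L2_space \<Omega>"
  by (rule L2_space_bound[of _ _ f "\<bar>c\<bar>"]) (auto dest: L2_spaceD)

lemma L2_space_add:
  assumes "f \<in> L2_space \<Omega>" "g \<in> L2_space \<Omega>"
  shows "(\<lambda>x. f x + g x) \<in> L2_space \<Omega>"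
proof -
  have m: "(\<lambda>x. f x + g x) \<in> borel_measurable (lebesgue_on \<Omega>)"
    using assms[THEN L2_spaceD(1)] by measurable
  have "integrable (lebesgue_on \<Omega>) (\<lambda>x. (norm (f x + g x))\<^sup>2)"
  proof (rule Bochner_Integration.integrable_bound)
    show "integrable (lebesgue_on \<Omega>) (\<lambda>x. 2 * (norm (f x))\<^sup>2 + 2 * (norm (g x))\<^sup>2)"
      using assms[THEN L2_spaceD(2)] by simp
    show "(\<lambda>x. (norm (f x + g x))\<^sup>2) \<in> borel_measurable (lebesgue_on \<Omega>)"
      using m by measurable
    have "(norm (a + b))\<^sup>2 \<le> 2 * (norm a)\<^sup>2 + 2 * (norm b)\<^sup>2" for a b :: 'b
      using zero_le_power2[of "norm (a - b)"] unfolding power2_norm_eq_inner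
      by (simp add: inner_diff inner_add inner_commute)
    then show "AE x in lebesgue_on \<Omega>. norm ((norm (f x + g x))\<^sup>2)
        \<le> norm (2 * (norm (f x))\<^sup>2 + 2 * (norm (g x))\<^sup>2)"
      by simp
  qed
  with m show ?thesis by (simp add: L2_space_def)
qed

lemma L2_space_diff:
  assumes "f \<in> L2_space \<Omega>" "g \<in> L2_space \<Omega>"
  shows "(\<lambda>x. f x - g x) \<in> L2_space \<Omega>"
  using L2_space_add[OF assms(1) L2_space_scaleR[OF assms(2), of "-1"]] by simp

lemma L2_space_zero: "(\<lambda>x. 0) \<in> L2_space \<Omega>"
  by (simp add: L2_space_def)

lemma L2_space_AE_cong:
  assumes "f \<in> L2_space \<Omega>" "g \<in> borel_measurable (lebesgue_on \<Omega>)" "AE x in lebesgue_on \<Omega>. f x = g x"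
  shows "g \<in> L2_space \<Omega>"
  using assms by (intro L2_space_bound[OF _ assms(1), of _ 1]) auto

lemma L2_integrable_inner:
  assumes "f \<in> L2_space \<Omega>" "g \<in> L2_space \<Omega>"
  shows "integrable (lebesgue_on \<Omega>) (\<lambda>x. f x \<bullet> g x)"
proof (rule Bochner_Integration.integrable_bound)
  show "integrable (lebesgue_on \<Omega>) (\<lambda>x. (norm (f x))\<^sup>2 + (norm (g x))\<^sup>2)"
    using assms[THEN L2_spaceD(2)] by simp
  show "(\<lambda>x. f x \<bullet> g x) \<in> borel_measurable (lebesgue_on \<Omega>)"
    using assms by (intro borel_measurable_inner) (auto dest: L2_spaceD)
  have "\<bar>a \<bullet> b\<bar> \<le> (norm a)\<^sup>2 + (norm b)\<^sup>2" for a b :: 'b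
  proof -
    have "\<bar>a \<bullet> b\<bar> \<le> norm a * norm b" by (rule Cauchy_Schwarz_ineq2)
    also have "\<dots> \<le> (norm a)\<^sup>2 + (norm b)\<^sup>2"
      using sum_squares_bound[of "norm a" "norm b"] mult_nonneg_nonneg[OF norm_ge_zero[of a] norm_ge_zero[of b]]
      by linarith
    finally show ?thesis .
  qed
  then show "AE x in lebesgue_on \<Omega>. norm (f x \<bullet> g x) \<le> norm ((norm (f x))\<^sup>2 + (norm (g x))\<^sup>2)"
    by simp
qed

\<comment> \<open>The type of square integrable classes and its inner product\<close>
\<comment> \<open>The relation is partial: it is reflexive only on square integrable functions, so
  every element of the type is a genuine L2 class.\<close>
quotient_type (overloaded) ('a, 'b) L2 =
  "'a::euclidean_space \<Rightarrow> 'b::euclidean_space" / partial: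
  "\<lambda>f g. f \<in> L2_space UNIV \<and> g \<in> L2_space UNIV \<and> (AE x in lebesgue. f x = g x)"
proof (rule part_equivpI)
  show "\<exists>f::'a \<Rightarrow> 'b. f \<in> L2_space UNIV \<and> f \<in> L2_space UNIV \<and> (AE x in lebesgue. f x = f x)"
    using L2_space_zero by blast
  show "symp (\<lambda>f g::'a \<Rightarrow> 'b. f \<in> L2_space UNIV \<and> g \<in> L2_space UNIV \<and> (AE x in lebesgue. f x = g x))"
  proof (intro sympI conjI; elim conjE)
    fix f g :: "'a \<Rightarrow> 'b"
    assume "AE x in lebesgue. f x = g x"
    then show "AE x in lebesgue. g x = f x" by eventually_elim simp
  qed
  show "transp (\<lambda>f g::'a \<Rightarrow> 'b. f \<in> L2_space UNIV \<and> g \<in> L2_space UNIV \<and> (AE x in lebesgue. f x = g x))"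
  proof (intro transpI conjI; elim conjE)
    fix f g h :: "'a \<Rightarrow> 'b"
    assume "AE x in lebesgue. f x = g x" "AE x in lebesgue. g x = h x"
    then show "AE x in lebesgue. f x = h x" by eventually_elim simp
  qed
qed

instantiation L2 :: (euclidean_space, euclidean_space) real_vector
begin

lift_definition zero_L2 :: "('a, 'b) L2" is "\<lambda>x. 0"
  by (simp add: L2_space_zero)

lift_definition plus_L2 :: "('a, 'b) L2 \<Rightarrow> ('a, 'b) L2 \<Rightarrow> ('a, 'b) L2" is "\<lambda>f g x. f x + g x"
  by (auto simp: L2_space_add)

lift_definition minus_L2 :: "('a, 'b) L2 \<Rightarrow> ('a, 'b) L2 \<Rightarrow> ('a, 'b) L2" is "\<lambda>f g x. f x - g x"
  by (auto simp: L2_space_diff)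

lift_definition uminus_L2 :: "('a, 'b) L2 \<Rightarrow> ('a, 'b) L2" is "\<lambda>f x. - f x"
  using L2_space_scaleR[of _ UNIV "-1"] by auto

lift_definition scaleR_L2 :: "real \<Rightarrow> ('a, 'b) L2 \<Rightarrow> ('a, 'b) L2" is "\<lambda>c f x. c *\<^sub>R f x"
  by (auto simp: L2_space_scaleR)

instance
proof
  fix f g h :: "('a, 'b) L2" and a b :: real
  show "f + g + h = f + (g + h)"
    by transfer (auto simp: L2_space_add add.assoc)
  show "f + g = g + f" by transfer (auto simp: L2_space_add add.commute)
  show "0 + f = f" by transfer (auto simp: L2_space_add)
  show "- f + f = 0" by transfer (auto simp: L2_space_zero)
  show "f - g = f + - g" by transfer (auto simp: L2_space_diff)
  show "a *\<^sub>R (f + g) = a *\<^sub>R f + a *\<^sub>R g"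
    by transfer (auto simp: L2_space_scaleR L2_space_add scaleR_add_right)
  show "(a + b) *\<^sub>R f = a *\<^sub>R f + b *\<^sub>R f"
    by transfer (auto simp: L2_space_scaleR L2_space_add scaleR_add_left)
  show "a *\<^sub>R b *\<^sub>R f = (a * b) *\<^sub>R f" by transfer (auto simp: L2_space_scaleR)
  show "1 *\<^sub>R f = f" by transfer auto
qed

end

instantiation L2 :: (euclidean_space, euclidean_space) real_inner
begin

lift_definition inner_L2 :: "('a, 'b) L2 \<Rightarrow> ('a, 'b) L2 \<Rightarrow> real" is
  "\<lambda>f g. LINT x|lebesgue. f x \<bullet> g x"
  by (intro integral_cong_AE)
     (auto simp: lebesgue_on_UNIV_eq intro!: borel_measurable_inner dest!: L2_spaceD(1))

definition norm_L2 :: "('a, 'b) L2 \<Rightarrow> real" where "norm_L2 f = sqrt (f \<bullet> f)"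

definition sgn_L2 :: "('a, 'b) L2 \<Rightarrow> ('a, 'b) L2" where "sgn_L2 f = f /\<^sub>R norm f"

definition dist_L2 :: "('a, 'b) L2 \<Rightarrow> ('a, 'b) L2 \<Rightarrow> real" where "dist_L2 f g = norm (f - g)"

definition uniformity_L2 :: "(('a, 'b) L2 \<times> ('a, 'b) L2) filter" where
  "uniformity_L2 = (INF e\<in>{0<..}. principal {(x, y). dist x y < e})"

definition open_L2 :: "('a, 'b) L2 set \<Rightarrow> bool" where
  "open_L2 U = (\<forall>x\<in>U. eventually (\<lambda>(x', y). x' = x \<longrightarrow> y \<in> U) uniformity)"

instance
proof
  fix f g h :: "('a, 'b) L2" and a :: real
  show "dist f g = norm (f - g)" by (rule dist_L2_def)
  show "sgn f = f /\<^sub>R norm f" by (rule sgn_L2_def)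
  show "uniformity = (INF e\<in>{0<..}. principal {(x::('a, 'b) L2, y). dist x y < e})"
    by (rule uniformity_L2_def)
  show "open U = (\<forall>x\<in>U. \<forall>\<^sub>F (x', y) in uniformity. x' = x \<longrightarrow> y \<in> U)" for U :: "('a, 'b) L2 set"
    by (rule open_L2_def)
  show "f \<bullet> g = g \<bullet> f" by transfer (simp add: inner_commute)
  show "(f + g) \<bullet> h = f \<bullet> h + g \<bullet> h"
    by transfer (simp add: inner_add_left L2_integrable_inner[where \<Omega> = UNIV, unfolded lebesgue_on_UNIV_eq])
  show "(a *\<^sub>R f) \<bullet> g = a * (f \<bullet> g)" by transfer simp
  show "0 \<le> f \<bullet> f" by transfer simp
  show "f \<bullet> f = 0 \<longleftrightarrow> f = 0"
  proof transfer
    fix f :: "'a \<Rightarrow> 'b"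
    assume f: "f \<in> L2_space UNIV \<and> f \<in> L2_space UNIV \<and> (AE x in lebesgue. f x = f x)"
    then have "(LINT x|lebesgue. f x \<bullet> f x) = 0 \<longleftrightarrow> (AE x in lebesgue. f x \<bullet> f x = 0)"
      using L2_integrable_inner[of f UNIV f]
      by (intro integral_nonneg_eq_0_iff_AE) (simp_all add: lebesgue_on_UNIV_eq)
    then show "(LINT x|lebesgue. f x \<bullet> f x) = 0 \<longleftrightarrow>
        f \<in> L2_space UNIV \<and> (\<lambda>x. 0) \<in> L2_space UNIV \<and> (AE x in lebesgue. f x = (0::'b))"
      using f L2_space_zero by auto
  qed
  show "norm f = sqrt (f \<bullet> f)" by (rule norm_L2_def)
qed

end

section \<open>Representatives and completeness\<close>

lemma rep_L2_space: "rep_L2 F \<in> L2_space UNIV"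
  using Quotient3_rep_reflp[OF Quotient3_L2] by blast

lemma abs_rep_L2: "abs_L2 (rep_L2 F) = F"
  by (rule Quotient3_abs_rep[OF Quotient3_L2])

lemma abs_L2_eq_iff:
  assumes "f \<in> L2_space UNIV" "g \<in> L2_space UNIV"
  shows "abs_L2 f = abs_L2 g \<longleftrightarrow> (AE x in lebesgue. f x = g x)"
  using Quotient3_rel[OF Quotient3_L2, of f g] assms by auto

lemma inner_abs_L2:
  "f \<in> L2_space UNIV \<Longrightarrow> g \<in> L2_space UNIV \<Longrightarrow> abs_L2 f \<bullet> abs_L2 g = (LINT x|lebesgue. f x \<bullet> g x)"
  by (simp add: inner_L2.abs_eq)

lemma abs_L2_diff:
  "f \<in> L2_space UNIV \<Longrightarrow> g \<in> L2_space UNIV \<Longrightarrow> abs_L2 f - abs_L2 g = abs_L2 (\<lambda>x. f x - g x)"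
  by (simp add: minus_L2.abs_eq)

lemma nn_integral_norm_L2:
  assumes f: "f \<in> L2_space UNIV"
  shows "(\<integral>\<^sup>+x. ennreal ((norm (f x))\<^sup>2) \<partial>lebesgue) = ennreal ((norm (abs_L2 f))\<^sup>2)"
proof -
  have "(\<integral>\<^sup>+x. ennreal ((norm (f x))\<^sup>2) \<partial>lebesgue) = ennreal (LINT x|lebesgue. (norm (f x))\<^sup>2)"
    using L2_spaceD(2)[OF f] by (intro nn_integral_eq_integral) (simp_all add: lebesgue_on_UNIV_eq)
  also have "(LINT x|lebesgue. (norm (f x))\<^sup>2) = (norm (abs_L2 f))\<^sup>2"
    by (simp add: power2_norm_eq_inner inner_abs_L2[OF f f])
  finally show ?thesis .
qed

lemma L2_space_UNIV_nn_integral: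
  assumes "f \<in> borel_measurable lebesgue" "(\<integral>\<^sup>+x. ennreal ((norm (f x))\<^sup>2) \<partial>lebesgue) < \<infinity>"
  shows "f \<in> L2_space UNIV"
  using assms by (auto simp: L2_space_def lebesgue_on_UNIV_eq integrable_iff_bounded)

text \<open>This is the Riesz-Fischer argument: a fast subsequence converges almost everywhere,
  Fatou's lemma shows that its pointwise limit is also the limit in norm, and the Cauchy property
  extends this to the whole sequence.\<close>

lemma L2_Cauchy_convergent:
  fixes X :: "nat \<Rightarrow> ('a::euclidean_space, 'b::euclidean_space) L2"
  assumes "Cauchy X"
  shows "convergent X"
proof -
  have "\<exists>N. \<forall>m\<ge>N. \<forall>n\<ge>N. dist (X m) (X n) < (1/2) ^ k" for k
    using metric_CauchyD[OF assms, of "(1/2) ^ k"] by simp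
  then obtain N where N: "\<And>k m n. m \<ge> N k \<Longrightarrow> n \<ge> N k \<Longrightarrow> dist (X m) (X n) < (1/2) ^ k"
    by metis
  \<comment> \<open>Summing the thresholds gives \<open>r m \<ge> N k\<close> for all
    \<open>k \<le> m\<close> at once, so the members of the subsequence from k on are within
    \<open>(1/2) ^ k\<close> of each other.\<close>
  define r where "r k = k + (\<Sum>j\<le>k. N j)" for k
  have r_ge: "k \<le> m \<Longrightarrow> N k \<le> r m" for k m
    unfolding r_def using member_le_sum[of k "{..m}" N] by simp
  have r_ge': "k \<le> r k" for k by (simp add: r_def)
  define h where "h k = rep_L2 (X (r k))" for k
  have hL: "h k \<in> L2_space UNIV" and habs: "abs_L2 (h k) = X (r k)" for k
    by (simp_all add: h_def rep_L2_space abs_rep_L2)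
  have hm[measurable]: "h k \<in> borel_measurable lebesgue" for k
    using L2_spaceD(1)[OF hL[of k]] by (simp add: lebesgue_on_UNIV_eq)
  have hdiff: "(\<integral>\<^sup>+x. ennreal ((norm (h m x - h n x))\<^sup>2) \<partial>lebesgue) \<le> ennreal (((1/2) ^ k)\<^sup>2)"
    if "k \<le> m" "k \<le> n" for k m n
  proof -
    have "norm (X (r m) - X (r n)) \<le> (1/2) ^ k"
      using N[OF r_ge r_ge, OF that] by (simp add: dist_norm)
    then have "(norm (X (r m) - X (r n)))\<^sup>2 \<le> ((1/2) ^ k)\<^sup>2" by (intro power_mono) auto
    moreover have "(\<integral>\<^sup>+x. ennreal ((norm (h m x - h n x))\<^sup>2) \<partial>lebesgue)
        = ennreal ((norm (X (r m) - X (r n)))\<^sup>2)"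
      using nn_integral_norm_L2[OF L2_space_diff[OF hL hL]]
      by (simp add: abs_L2_diff[OF hL hL, symmetric] habs)
    ultimately show ?thesis by (simp add: ennreal_leI)
  qed
  \<comment> \<open>The squared increments have integrals at most \<open>(1/4) ^ k\<close>, so the
    weight \<open>2 ^ k\<close> keeps the series integrable. The weight also turns square
    summability into absolute summability, by
    \<open>2 * d \<le> (1/2) ^ k + 2 ^ k * d^2\<close>.\<close>
  let ?q = "\<lambda>k x. 2 ^ k * (norm (h (Suc k) x - h k x))\<^sup>2"
  have "(\<integral>\<^sup>+x. (\<Sum>k. ennreal (?q k x)) \<partial>lebesgue) = (\<Sum>k. \<integral>\<^sup>+x. ennreal (?q k x) \<partial>lebesgue)"
    by (rule nn_integral_suminf) measurable
  also have "\<dots> \<le> (\<Sum>k. ennreal ((1/2) ^ k))"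
  proof (rule suminf_le)
    fix k
    have "(\<integral>\<^sup>+x. ennreal (?q k x) \<partial>lebesgue)
        = ennreal (2 ^ k) * (\<integral>\<^sup>+x. ennreal ((norm (h (Suc k) x - h k x))\<^sup>2) \<partial>lebesgue)"
      by (simp add: ennreal_mult nn_integral_cmult)
    also have "\<dots> \<le> ennreal (2 ^ k) * ennreal (((1/2) ^ k)\<^sup>2)"
      using hdiff[of k "Suc k" k] by (intro mult_left_mono) auto
    also have "\<dots> = ennreal (2 ^ k * ((1/2) ^ k)\<^sup>2)"
      by (simp add: ennreal_mult)
    also have "2 ^ k * ((1/2) ^ k)\<^sup>2 = ((1/2) ^ k :: real)"
      by (simp add: power2_eq_square power_one_over field_simps)
    finally show "(\<integral>\<^sup>+x. ennreal (?q k x) \<partial>lebesgue) \<le> ennreal ((1/2) ^ k)" .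
  qed auto
  also have "\<dots> = ennreal (\<Sum>k. (1/2) ^ k)"
    by (rule suminf_ennreal2) (auto intro: summable_geometric)
  finally have "(\<integral>\<^sup>+x. (\<Sum>k. ennreal (?q k x)) \<partial>lebesgue) \<noteq> \<infinity>"
    by (auto simp: top_unique)
  then have "AE x in lebesgue. (\<Sum>k. ennreal (?q k x)) \<noteq> \<infinity>"
    by (intro nn_integral_noteq_infinite) auto
  then have conv: "AE x in lebesgue. convergent (\<lambda>k. h k x)"
  proof eventually_elim
    case (elim x)
    then have sq: "summable (\<lambda>k. ?q k x)"
      by (intro summable_suminf_not_top) auto
    have "summable (\<lambda>k. (1/2) ^ k + ?q k x)"
      by (intro summable_add sq summable_geometric) auto
    moreover have "norm (norm (h (Suc k) x - h k x)) \<le> (1/2) ^ k + ?q k x" for k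
    proof -
      define d where "d = norm (h (Suc k) x - h k x)"
      have "2 * d \<le> (1/2) ^ k + 2 ^ k * d\<^sup>2"
        using zero_le_power2[of "1 - 2 ^ k * d"]
        by (simp add: power2_eq_square power_one_over field_simps)
      moreover have "d \<ge> 0" by (simp add: d_def)
      ultimately have "d \<le> (1/2) ^ k + 2 ^ k * d\<^sup>2" by linarith
      then show ?thesis by (simp add: d_def)
    qed
    ultimately have "summable (\<lambda>k. norm (h (Suc k) x - h k x))"
      by (rule summable_comparison_test'[where N = 0])
    then have "summable (\<lambda>k. h (Suc k) x - h k x)" by (rule summable_norm_cancel)
    then have "convergent (\<lambda>n. \<Sum>k<n. h (Suc k) x - h k x)" by (simp add: summable_iff_convergent)
    then have "convergent (\<lambda>n. (\<Sum>k<n. h (Suc k) x - h k x) + h 0 x)"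
      by (intro convergent_add convergent_const)
    then show ?case using sum_lessThan_telescope[of "\<lambda>k. h k x"] by simp
  qed
  define f where "f x = lim (\<lambda>k. h k x)" for x
  have fm[measurable]: "f \<in> borel_measurable lebesgue"
    unfolding f_def by measurable
  \<comment> \<open>Fatou's lemma as m grows in \<open>hdiff\<close>, with k fixed.\<close>
  have fh: "(\<integral>\<^sup>+x. ennreal ((norm (f x - h k x))\<^sup>2) \<partial>lebesgue) \<le> ennreal (((1/2) ^ k)\<^sup>2)" for k
  proof -
    have "AE x in lebesgue. liminf (\<lambda>m. ennreal ((norm (h m x - h k x))\<^sup>2)) = ennreal ((norm (f x - h k x))\<^sup>2)"
      using conv
    proof eventually_elim
      case (elim x)
      then have "(\<lambda>m. h m x) \<longlonglongrightarrow> f x" by (simp add: f_def convergent_LIMSEQ_iff)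
      then have "(\<lambda>m. ennreal ((norm (h m x - h k x))\<^sup>2)) \<longlonglongrightarrow> ennreal ((norm (f x - h k x))\<^sup>2)"
        by (intro tendsto_intros)
      then show ?case by (intro lim_imp_Liminf) auto
    qed
    then have "(\<integral>\<^sup>+x. ennreal ((norm (f x - h k x))\<^sup>2) \<partial>lebesgue)
        = (\<integral>\<^sup>+x. liminf (\<lambda>m. ennreal ((norm (h m x - h k x))\<^sup>2)) \<partial>lebesgue)"
      by (intro nn_integral_cong_AE) auto
    also have "\<dots> \<le> liminf (\<lambda>m. \<integral>\<^sup>+x. ennreal ((norm (h m x - h k x))\<^sup>2) \<partial>lebesgue)"
      by (rule nn_integral_liminf) measurable
    also have "\<dots> \<le> ennreal (((1/2) ^ k)\<^sup>2)"
      by (intro Liminf_le eventually_sequentiallyI[of k] hdiff) auto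
    finally show ?thesis .
  qed
  have fhL: "(\<lambda>x. f x - h k x) \<in> L2_space UNIV" for k
  proof (rule L2_space_UNIV_nn_integral)
    show "(\<integral>\<^sup>+x. ennreal ((norm (f x - h k x))\<^sup>2) \<partial>lebesgue) < \<infinity>"
      by (rule le_less_trans[OF fh[of k]]) simp
  qed measurable
  have fL: "f \<in> L2_space UNIV"
    using L2_space_add[OF fhL[of 0] hL[of 0]] by simp
  have near: "dist (X (r k)) (abs_L2 f) \<le> (1/2) ^ k" for k
  proof -
    have "ennreal ((norm (abs_L2 f - X (r k)))\<^sup>2) \<le> ennreal (((1/2) ^ k)\<^sup>2)"
      using fh[of k] nn_integral_norm_L2[OF fhL[of k]]
      by (simp add: abs_L2_diff[OF fL hL, symmetric] habs)
    then have "(norm (abs_L2 f - X (r k)))\<^sup>2 \<le> ((1/2) ^ k)\<^sup>2"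
      by (subst (asm) ennreal_le_iff) auto
    then show ?thesis by (subst dist_commute, unfold dist_norm) (rule power2_le_imp_le, auto)
  qed
  have "X \<longlonglongrightarrow> abs_L2 f"
  proof (rule metric_LIMSEQ_I)
    fix e :: real assume "e > 0"
    then obtain k where k: "(1/2) ^ k < e / 2"
      using real_arch_pow_inv[of "e / 2" "1/2"] by auto
    have "dist (X m) (abs_L2 f) < e" if "m \<ge> N k" for m
    proof -
      have "dist (X m) (abs_L2 f) \<le> dist (X m) (X (r k)) + dist (X (r k)) (abs_L2 f)"
        by (rule dist_triangle)
      with N[OF that r_ge[OF order_refl]] near[of k] k show ?thesis by linarith
    qed
    then show "\<exists>no. \<forall>n\<ge>no. dist (X n) (abs_L2 f) < e" by blast
  qed
  then show ?thesis by (rule convergentI)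
qed

instance L2 :: (euclidean_space, euclidean_space) complete_space
  by standard (rule L2_Cauchy_convergent)

section \<open>Functions on \<Omega> as classes on the whole space\<close>

text \<open>Extension by zero embeds the L2 space over \<Omega> isometrically; the image consists of
  the classes that vanish almost everywhere off \<Omega>.\<close>

definition L2_of :: "'a::euclidean_space set \<Rightarrow> ('a \<Rightarrow> 'b::euclidean_space) \<Rightarrow> ('a, 'b) L2" where
  "L2_of \<Omega> f = abs_L2 (\<lambda>x. indicator \<Omega> x *\<^sub>R f x)"

lemma L2_space_indicator:
  assumes [measurable]: "\<Omega> \<in> sets lebesgue" and f: "f \<in> L2_space \<Omega>"
  shows "(\<lambda>x. indicator \<Omega> x *\<^sub>R f x) \<in> L2_space UNIV"
proof -
  have "(\<lambda>x. (norm (indicator \<Omega> x *\<^sub>R f x))\<^sup>2) = (\<lambda>x. indicator \<Omega> x *\<^sub>R (norm (f x))\<^sup>2)"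
    by (auto simp: indicator_def)
  then show ?thesis
    using L2_spaceD[OF f]
    by (simp add: L2_space_def lebesgue_on_UNIV_eq borel_measurable_restrict_space_iff integrable_restrict_space)
qed

lemma L2_space_restrict:
  assumes [measurable]: "\<Omega> \<in> sets lebesgue" and f: "f \<in> L2_space UNIV"
  shows "f \<in> L2_space \<Omega>"
proof -
  have "f \<in> borel_measurable (lebesgue_on \<Omega>)"
    using L2_spaceD(1)[OF f] by (simp add: lebesgue_on_UNIV_eq measurable_restrict_space1)
  moreover have "integrable lebesgue (\<lambda>x. indicator \<Omega> x *\<^sub>R (norm (f x))\<^sup>2)"
    using L2_spaceD(2)[OF f] by (intro integrable_mult_indicator) (simp_all add: lebesgue_on_UNIV_eq)
  ultimately show ?thesis by (simp add: L2_space_def integrable_restrict_space)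
qed

lemma inner_L2_of:
  assumes "\<Omega> \<in> sets lebesgue" "f \<in> L2_space \<Omega>" "g \<in> L2_space \<Omega>"
  shows "L2_of \<Omega> f \<bullet> L2_of \<Omega> g = (LINT x|lebesgue_on \<Omega>. f x \<bullet> g x)"
proof -
  have "(\<lambda>x. (indicator \<Omega> x *\<^sub>R f x) \<bullet> (indicator \<Omega> x *\<^sub>R g x)) = (\<lambda>x. indicator \<Omega> x *\<^sub>R (f x \<bullet> g x))"
    by (auto simp: indicator_def)
  then show ?thesis
    using assms by (simp add: L2_of_def inner_abs_L2 L2_space_indicator integral_restrict_space)
qed

lemma norm_L2_of:
  assumes "\<Omega> \<in> sets lebesgue" "f \<in> L2_space \<Omega>"
  shows "norm (L2_of \<Omega> f) = L2_norm \<Omega> f"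
  using inner_L2_of[OF assms(1,2,2)] by (simp add: L2_norm_def norm_eq_sqrt_inner)

lemma L2_of_eq_iff:
  assumes "\<Omega> \<in> sets lebesgue" "f \<in> L2_space \<Omega>" "g \<in> L2_space \<Omega>"
  shows "L2_of \<Omega> f = L2_of \<Omega> g \<longleftrightarrow> (AE x in lebesgue_on \<Omega>. f x = g x)"
proof -
  have "indicator \<Omega> x *\<^sub>R f x = indicator \<Omega> x *\<^sub>R g x \<longleftrightarrow> (x \<in> \<Omega> \<longrightarrow> f x = g x)" for x
    by (auto simp: indicator_def)
  then show ?thesis
    using assms by (simp add: L2_of_def abs_L2_eq_iff L2_space_indicator AE_restrict_space_iff)
qed

lemma L2_of_add:
  assumes "\<Omega> \<in> sets lebesgue" "f \<in> L2_space \<Omega>" "g \<in> L2_space \<Omega>"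
  shows "L2_of \<Omega> (\<lambda>x. f x + g x) = L2_of \<Omega> f + L2_of \<Omega> g"
  using assms by (simp add: L2_of_def plus_L2.abs_eq L2_space_indicator scaleR_add_right)

lemma L2_of_scaleR:
  assumes "\<Omega> \<in> sets lebesgue" "f \<in> L2_space \<Omega>"
  shows "L2_of \<Omega> (\<lambda>x. c *\<^sub>R f x) = c *\<^sub>R L2_of \<Omega> f"
  using assms by (simp add: L2_of_def scaleR_L2.abs_eq L2_space_indicator mult.commute)

section \<open>Pointwise linear operators on classes\<close>

text \<open>Since \<open>L2_of\<close> also cuts off outside \<Omega>, the identity fibre map yields
  the projection onto the classes that vanish off \<Omega>.\<close>

definition L2_map ::
  "'a::euclidean_space set \<Rightarrow> ('a \<Rightarrow> 'b::euclidean_space \<Rightarrow> 'c::euclidean_space) \<Rightarrow> ('a, 'b) L2 \<Rightarrow> ('a, 'c) L2" where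
  "L2_map \<Omega> T F = L2_of \<Omega> (\<lambda>x. T x (rep_L2 F x))"

text \<open>One notion covers multiplication of vectors by a scalar coefficient, multiplication of
  scalars by a vector field, and the identity. Testing measurability on measurable functions f
  avoids a measurable structure on the linear maps.\<close>

definition bounded_fibre_map ::
  "'a::euclidean_space set \<Rightarrow> ('a \<Rightarrow> 'b::euclidean_space \<Rightarrow> 'c::euclidean_space) \<Rightarrow> real \<Rightarrow> bool" where
  "bounded_fibre_map \<Omega> T K \<longleftrightarrow> \<Omega> \<in> sets lebesgue \<and> (\<forall>x. linear (T x)) \<and>
     (\<forall>f\<in>borel_measurable (lebesgue_on \<Omega>). (\<lambda>x. T x (f x)) \<in> borel_measurable (lebesgue_on \<Omega>)) \<and>
     (AE x in lebesgue_on \<Omega>. \<forall>y. norm (T x y) \<le> K * norm y)"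

lemma bounded_fibre_map_L2:
  assumes "bounded_fibre_map \<Omega> T K" "f \<in> L2_space \<Omega>"
  shows "(\<lambda>x. T x (f x)) \<in> L2_space \<Omega>"
  using assms
  by (intro L2_space_bound[OF _ assms(2), of _ K]) (auto simp: bounded_fibre_map_def dest: L2_spaceD(1))

text \<open>The operator is defined through an arbitrary representative. Two representatives agree
  off a null set, and a pointwise map preserves this.\<close>

lemma L2_map_of:
  assumes T: "bounded_fibre_map \<Omega> T K" and f: "f \<in> L2_space \<Omega>"
  shows "L2_map \<Omega> T (L2_of \<Omega> f) = L2_of \<Omega> (\<lambda>x. T x (f x))"
proof -
  have \<Omega>: "\<Omega> \<in> sets lebesgue" using T by (simp add: bounded_fibre_map_def)
  let ?g = "rep_L2 (L2_of \<Omega> f)"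
  have g: "?g \<in> L2_space UNIV" by (rule rep_L2_space)
  have "abs_L2 ?g = abs_L2 (\<lambda>x. indicator \<Omega> x *\<^sub>R f x)"
    by (simp add: abs_rep_L2 L2_of_def)
  then have "AE x in lebesgue. ?g x = indicator \<Omega> x *\<^sub>R f x"
    by (simp add: abs_L2_eq_iff[OF g L2_space_indicator[OF \<Omega> f]])
  then have "AE x in lebesgue_on \<Omega>. T x (?g x) = T x (f x)"
    using \<Omega> by (auto simp: AE_restrict_space_iff elim!: eventually_mono)
  then show ?thesis
    unfolding L2_map_def
    using L2_of_eq_iff[OF \<Omega> bounded_fibre_map_L2[OF T L2_space_restrict[OF \<Omega> g]] bounded_fibre_map_L2[OF T f]]
    by simp
qed

lemma L2_map_norm:
  assumes T: "bounded_fibre_map \<Omega> T K" and K: "K \<ge> 0"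
  shows "norm (L2_map \<Omega> T F) \<le> K * norm F"
proof -
  have \<Omega>: "\<Omega> \<in> sets lebesgue" using T by (simp add: bounded_fibre_map_def)
  let ?f = "rep_L2 F"
  have f: "?f \<in> L2_space UNIV" by (rule rep_L2_space)
  note Tf = bounded_fibre_map_L2[OF T L2_space_restrict[OF \<Omega> f]]
  let ?g = "\<lambda>x. indicator \<Omega> x *\<^sub>R T x (?f x)"
  note Tg = L2_space_indicator[OF \<Omega> Tf]
  have "AE x in lebesgue. norm (?g x) \<le> K * norm (?f x)"
    using T K \<Omega> by (auto simp: bounded_fibre_map_def AE_restrict_space_iff indicator_def elim!: eventually_mono)
  then have le: "AE x in lebesgue. (norm (?g x))\<^sup>2 \<le> K\<^sup>2 * (norm (?f x))\<^sup>2"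
    by eventually_elim (metis norm_ge_zero power_mono power_mult_distrib)
  have "(norm (L2_map \<Omega> T F))\<^sup>2 = (LINT x|lebesgue. (norm (?g x))\<^sup>2)"
    unfolding L2_map_def L2_of_def power2_norm_eq_inner by (rule inner_abs_L2[OF Tg Tg])
  also have "\<dots> \<le> (LINT x|lebesgue. K\<^sup>2 * (norm (?f x))\<^sup>2)"
    using L2_spaceD(2)[OF f] L2_spaceD(2)[OF Tg] le
    by (intro integral_mono_AE) (simp_all add: lebesgue_on_UNIV_eq)
  also have "\<dots> = (K * norm F)\<^sup>2"
    using inner_abs_L2[OF f f] by (simp add: abs_rep_L2 power2_norm_eq_inner power_mult_distrib)
  finally show ?thesis
    by (rule power2_le_imp_le) (use K in simp)
qed

lemma rep_L2_add: "AE x in lebesgue. rep_L2 (F + G) x = rep_L2 F x + rep_L2 G x"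
proof -
  have "abs_L2 (rep_L2 (F + G)) = abs_L2 (\<lambda>x. rep_L2 F x + rep_L2 G x)"
    using plus_L2.abs_eq[of "rep_L2 F" "rep_L2 G"] by (simp add: abs_rep_L2 rep_L2_space)
  then show ?thesis by (simp add: abs_L2_eq_iff rep_L2_space L2_space_add)
qed

lemma rep_L2_scaleR: "AE x in lebesgue. rep_L2 (c *\<^sub>R F) x = c *\<^sub>R rep_L2 F x"
proof -
  have "abs_L2 (rep_L2 (c *\<^sub>R F)) = abs_L2 (\<lambda>x. c *\<^sub>R rep_L2 F x)"
    using scaleR_L2.abs_eq[of "rep_L2 F" c] by (simp add: abs_rep_L2 rep_L2_space)
  then show ?thesis by (simp add: abs_L2_eq_iff rep_L2_space L2_space_scaleR)
qed

lemma L2_map_bounded_linear: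
  assumes T: "bounded_fibre_map \<Omega> T K" and K: "K \<ge> 0"
  shows "bounded_linear (L2_map \<Omega> T)"
proof (rule bounded_linear_intro[where K = K])
  have \<Omega>: "\<Omega> \<in> sets lebesgue" and lin: "\<And>x. linear (T x)"
    using T by (simp_all add: bounded_fibre_map_def)
  note r = L2_space_restrict[OF \<Omega> rep_L2_space]
  note Tr = bounded_fibre_map_L2[OF T r]
  fix F G and c :: real
  have "AE x in lebesgue_on \<Omega>. T x (rep_L2 (F + G) x) = T x (rep_L2 F x) + T x (rep_L2 G x)"
    using rep_L2_add[of F G] \<Omega>
    by (auto simp: AE_restrict_space_iff linear_add[OF lin] elim!: eventually_mono)
  then show "L2_map \<Omega> T (F + G) = L2_map \<Omega> T F + L2_map \<Omega> T G"
    unfolding L2_map_def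
    by (subst L2_of_add[OF \<Omega> Tr Tr, symmetric], subst L2_of_eq_iff[OF \<Omega> Tr L2_space_add[OF Tr Tr]])
  have "AE x in lebesgue_on \<Omega>. T x (rep_L2 (c *\<^sub>R F) x) = c *\<^sub>R T x (rep_L2 F x)"
    using rep_L2_scaleR[of c F] \<Omega>
    by (auto simp: AE_restrict_space_iff linear_scale[OF lin] elim!: eventually_mono)
  then show "L2_map \<Omega> T (c *\<^sub>R F) = c *\<^sub>R L2_map \<Omega> T F"
    unfolding L2_map_def
    by (subst L2_of_scaleR[OF \<Omega> Tr, symmetric], subst L2_of_eq_iff[OF \<Omega> Tr L2_space_scaleR[OF Tr]])
  show "norm (L2_map \<Omega> T F) \<le> norm F * K"
    using L2_map_norm[OF T K, of F] by (simp add: mult.commute)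
qed

section \<open>Smooth functions and cut-offs of boxes\<close>

text \<open>The classical flat function \<open>exp (- 1 / t)\<close> with inverse powers as extra
  factors: the extra index makes the linear span of the family closed under differentiation, so
  smoothness follows by induction.\<close>

definition exp_inv :: "nat \<Rightarrow> real \<Rightarrow> real" where
  "exp_inv j t = (if t > 0 then exp (- inverse t) * inverse t ^ j else 0)"

text \<open>With \<open>s = 1 / t\<close>, the exponential series dominates its single term
  \<open>s ^ Suc j / fact (Suc j)\<close>. The linear bound is what makes the difference quotients
  at 0 tend to 0.\<close>

lemma exp_inv_bound: "exp_inv j t \<le> fact (Suc j) * \<bar>t\<bar>"
proof (cases "t > 0")
  case True
  define s where "s = inverse t"
  have s: "s > 0" using True by (simp add: s_def)
  have "s ^ Suc j / fact (Suc j) \<le> exp s"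
  proof -
    have "(\<Sum>k\<in>{Suc j}. s ^ k /\<^sub>R fact k) \<le> (\<Sum>k. s ^ k /\<^sub>R fact k)"
      using s by (intro sum_le_suminf sums_summable[OF exp_converges]) auto
    then show ?thesis using sums_unique[OF exp_converges[of s]] by (simp add: divide_inverse mult.commute)
  qed
  then have "s * s ^ j \<le> fact (Suc j) * exp s"
    by (subst (asm) pos_divide_le_eq) (simp_all only: fact_gt_zero power_Suc mult.commute)
  then have "exp (- s) * s ^ j \<le> fact (Suc j) * inverse s"
    using s by (simp add: exp_minus field_simps)
  then show ?thesis using True by (simp add: exp_inv_def s_def)
next
  case False
  then have "exp_inv j t = 0" by (simp add: exp_inv_def)
  then show ?thesis by (simp only: fact_ge_zero abs_ge_zero mult_nonneg_nonneg)
qed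

lemma DERIV_exp_inv:
  "(exp_inv j has_real_derivative exp_inv (j + 2) t - real j * exp_inv (j + 1) t) (at t)"
proof (cases t "0::real" rule: linorder_cases)
  case less
  have "((\<lambda>_. 0) has_real_derivative 0) (at t)" by simp
  then have "(exp_inv j has_real_derivative 0) (at t)"
    by (rule has_field_derivative_transform_within_open[where S = "{..<0}"])
       (use less in \<open>auto simp: exp_inv_def\<close>)
  then show ?thesis using less by (simp add: exp_inv_def)
next
  case greater
  have "((\<lambda>t. exp (- inverse t) * inverse t ^ j) has_real_derivative
      exp (- inverse t) * (inverse t)\<^sup>2 * inverse t ^ j
        - exp (- inverse t) * (real j * (inverse t)\<^sup>2 * inverse t ^ (j - Suc 0))) (at t)"
    using greater by (auto intro!: derivative_eq_intros simp: power2_eq_square)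
  moreover have "real j * (inverse t)\<^sup>2 * inverse t ^ (j - Suc 0) = real j * inverse t ^ (j + 1)"
    by (cases j) (auto simp: power2_eq_square)
  ultimately have "((\<lambda>t. exp (- inverse t) * inverse t ^ j) has_real_derivative
      exp (- inverse t) * (inverse t)\<^sup>2 * inverse t ^ j
        - exp (- inverse t) * (real j * inverse t ^ (j + 1))) (at t)"
    by (simp only:)
  then have "((\<lambda>t. exp (- inverse t) * inverse t ^ j) has_real_derivative
      exp_inv (j + 2) t - real j * exp_inv (j + 1) t) (at t)"
    using greater by (simp add: exp_inv_def power2_eq_square mult.assoc mult.left_commute)
  then show ?thesis
    by (rule has_field_derivative_transform_within_open[where S = "{0<..}"])
       (use greater in \<open>auto simp: exp_inv_def\<close>)
next
  case equal
  \<comment> \<open>The function vanishes at 0, so the quotient is \<open>exp_inv (Suc j) h\<close>,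
    to which the linear bound applies with the next index.\<close>
  have "(\<lambda>h. (exp_inv j h - exp_inv j 0) / (h - 0)) \<midarrow>0\<rightarrow> 0"
  proof (rule Lim_null_comparison)
    have "norm ((exp_inv j h - exp_inv j 0) / (h - 0)) \<le> fact (Suc (Suc j)) * \<bar>h\<bar>" for h
    proof -
      have "norm ((exp_inv j h - exp_inv j 0) / (h - 0)) = exp_inv (Suc j) h"
        by (auto simp: exp_inv_def divide_inverse abs_mult power_abs)
      then show ?thesis using exp_inv_bound[of "Suc j" h] by simp
    qed
    then show "\<forall>\<^sub>F h in at 0. norm ((exp_inv j h - exp_inv j 0) / (h - 0)) \<le> fact (Suc (Suc j)) * \<bar>h\<bar>"
      by (intro always_eventually allI)
    have "((\<lambda>h::real. fact (Suc (Suc j)) * \<bar>h\<bar>) \<longlongrightarrow> fact (Suc (Suc j)) * \<bar>0\<bar>) (at 0)"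
      by (intro tendsto_intros)
    then show "((\<lambda>h::real. fact (Suc (Suc j)) * \<bar>h\<bar>) \<longlongrightarrow> 0) (at 0)" by simp
  qed
  then show ?thesis
    using equal by (simp add: has_field_derivative_iff exp_inv_def)
qed

section \<open>Rules for functions with continuous derivatives up to order k\<close>

lemma C_k_Suc_imp: "C_k (Suc k) f \<Longrightarrow> C_k k f"
proof (induction k arbitrary: f)
  case 0
  then show ?case
    by (auto simp: continuous_on_eq_continuous_at intro: differentiable_imp_continuous_within)
next
  case (Suc k)
  from Suc.prems show ?case by (auto intro!: Suc.IH)
qed

lemma C_k_const: "C_k k (\<lambda>x. c)"
  by (induction k arbitrary: c) auto

lemma C_k_add: "C_k k f \<Longrightarrow> C_k k g \<Longrightarrow> C_k k (\<lambda>x. f x + g x)"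
proof (induction k arbitrary: f g)
  case (Suc k)
  have "(f has_derivative frechet_derivative f (at x)) (at x)"
       "(g has_derivative frechet_derivative g (at x)) (at x)" for x
    using Suc.prems by (simp_all add: frechet_derivative_works)
  from has_derivative_add[OF this, THEN frechet_derivative_at, THEN sym]
  have "frechet_derivative (\<lambda>x. f x + g x) (at x) i
      = frechet_derivative f (at x) i + frechet_derivative g (at x) i" for x i
    by simp
  with Suc show ?case by auto
qed (auto intro: continuous_intros)

lemma C_k_mult: "C_k k f \<Longrightarrow> C_k k g \<Longrightarrow> C_k k (\<lambda>x. f x * g x)"
proof (induction k arbitrary: f g)
  case (Suc k)
  have "(f has_derivative frechet_derivative f (at x)) (at x)"
       "(g has_derivative frechet_derivative g (at x)) (at x)" for x
    using Suc.prems by (simp_all add: frechet_derivative_works)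
  from has_derivative_mult[OF this, THEN frechet_derivative_at, THEN sym]
  have "frechet_derivative (\<lambda>x. f x * g x) (at x) i
      = f x * frechet_derivative g (at x) i + frechet_derivative f (at x) i * g x" for x i
    by simp
  moreover have "C_k k f" "C_k k g" using Suc.prems C_k_Suc_imp by blast+
  ultimately show ?case using Suc by (auto intro!: C_k_add)
qed (auto intro: continuous_intros)

lemma C_k_prod: "(\<And>b. b \<in> B \<Longrightarrow> C_k k (f b)) \<Longrightarrow> C_k k (\<lambda>x. \<Prod>b\<in>B. f b x)"
  by (induction B rule: infinite_finite_induct) (auto intro: C_k_const C_k_mult)

text \<open>The index j is general in the induction because a partial derivative is a combination of
  the members j + 1 and j + 2.\<close>

lemma C_k_exp_inv_affine: "C_k k (\<lambda>x. exp_inv j (x \<bullet> b + c))"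
proof (induction k arbitrary: j)
  case 0
  have "continuous_on UNIV (exp_inv j)"
    using DERIV_exp_inv DERIV_isCont continuous_at_imp_continuous_on by blast
  then show ?case
    by (auto intro!: continuous_on_compose2[of UNIV "exp_inv j"] continuous_intros)
next
  case (Suc k)
  have der: "((\<lambda>x. exp_inv j (x \<bullet> b + c)) has_derivative
      (\<lambda>h. (h \<bullet> b) * (exp_inv (j + 2) (x \<bullet> b + c) - real j * exp_inv (j + 1) (x \<bullet> b + c)))) (at x)" for x
  proof -
    have "((\<lambda>x. x \<bullet> b + c) has_derivative (\<lambda>h. h \<bullet> b)) (at x)"
      by (auto intro!: derivative_eq_intros)
    from has_derivative_compose[OF this DERIV_exp_inv[unfolded has_field_derivative_def]]
    show ?thesis by (simp add: mult.commute)
  qed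
  have "C_k k (\<lambda>x. (i \<bullet> b) * (exp_inv (j + 2) (x \<bullet> b + c) + (- real j) * exp_inv (j + 1) (x \<bullet> b + c)))" for i
    by (intro C_k_mult C_k_add C_k_const Suc)
  then show ?case
    using der by (auto simp: differentiable_def frechet_derivative_at[OF der, symmetric])
qed

text \<open>Each factor is \<open>exp (- 1 / (m * t))\<close>, where t is the signed distance to a
  face. Inside the box it tends to 1 as m grows, and it is 0 once a face is crossed. This
  approximates the indicator of a box by test functions without convolution. The affine arguments
  have the shape required by \<open>C_k_exp_inv_affine\<close>.\<close>

definition box_cutoff :: "nat \<Rightarrow> 'a::euclidean_space \<Rightarrow> 'a \<Rightarrow> 'a \<Rightarrow> real" where
  "box_cutoff m a c x =
     (\<Prod>b\<in>Basis. exp_inv 0 (x \<bullet> (real m *\<^sub>R b) + - (real m * (a \<bullet> b))) *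
                  exp_inv 0 (x \<bullet> (- real m *\<^sub>R b) + real m * (c \<bullet> b)))"

lemma box_cutoff_eq_0:
  assumes "x \<notin> box a c"
  shows "box_cutoff m a c x = 0"
proof -
  obtain b where b: "b \<in> Basis" "\<not> (a \<bullet> b < x \<bullet> b \<and> x \<bullet> b < c \<bullet> b)"
    using assms by (auto simp: mem_box)
  have "m * (x \<bullet> b) - m * (a \<bullet> b) \<le> 0 \<or> m * (c \<bullet> b) - m * (x \<bullet> b) \<le> 0"
    using b(2) mult_left_mono[of _ _ "real m"] by force
  then show ?thesis
    unfolding box_cutoff_def using b(1)
    by (intro prod_zero[OF finite_Basis] bexI[of _ b]) (auto simp: exp_inv_def)
qed

lemma box_cutoff_bounds: "0 \<le> box_cutoff m a c x" "box_cutoff m a c x \<le> 1"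
proof -
  have e: "0 \<le> exp_inv 0 t" "exp_inv 0 t \<le> 1" for t by (auto simp: exp_inv_def)
  show "0 \<le> box_cutoff m a c x"
    unfolding box_cutoff_def by (intro prod_nonneg mult_nonneg_nonneg e ballI)
  show "box_cutoff m a c x \<le> 1"
    unfolding box_cutoff_def by (intro prod_le_1 conjI mult_nonneg_nonneg mult_le_one e)
qed

lemma box_cutoff_tendsto: "(\<lambda>m. box_cutoff m a c x) \<longlonglongrightarrow> indicator (box a c) x"
proof (cases "x \<in> box a c")
  case True
  have e: "(\<lambda>m. exp_inv 0 (real m * t)) \<longlonglongrightarrow> 1" if "t > 0" for t
  proof -
    have "(\<lambda>m. exp (- (inverse (real m) * inverse t))) \<longlonglongrightarrow> exp (- (0 * inverse t))"
      by (intro tendsto_intros lim_inverse_n)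
    moreover have "eventually (\<lambda>m. exp (- (inverse (real m) * inverse t)) = exp_inv 0 (real m * t)) sequentially"
      using eventually_gt_at_top[of 0] by eventually_elim (use that in \<open>simp add: exp_inv_def\<close>)
    ultimately show ?thesis by (simp add: tendsto_cong)
  qed
  have "(\<lambda>m. box_cutoff m a c x) \<longlonglongrightarrow> (\<Prod>b\<in>(Basis::'a set). 1 * 1)"
    unfolding box_cutoff_def
  proof (intro tendsto_prod tendsto_mult)
    fix b :: 'a assume "b \<in> Basis"
    then have p: "x \<bullet> b - a \<bullet> b > 0" "c \<bullet> b - x \<bullet> b > 0" using True by (auto simp: mem_box)
    show "(\<lambda>m. exp_inv 0 (x \<bullet> (real m *\<^sub>R b) + - (real m * (a \<bullet> b)))) \<longlonglongrightarrow> 1"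
      using e[OF p(1)] by (simp add: algebra_simps)
    show "(\<lambda>m. exp_inv 0 (x \<bullet> (- real m *\<^sub>R b) + real m * (c \<bullet> b))) \<longlonglongrightarrow> 1"
      using e[OF p(2)] by (simp add: algebra_simps)
  qed
  with True show ?thesis by simp
qed (simp add: box_cutoff_eq_0)

lemma box_cutoff_test:
  assumes "cbox a c \<subseteq> \<Omega>"
  shows "box_cutoff m a c \<in> test_functions \<Omega>"
proof -
  have "{x. box_cutoff m a c x \<noteq> 0} \<subseteq> cbox a c"
    using box_cutoff_eq_0 box_subset_cbox by blast
  then have cl: "closure {x. box_cutoff m a c x \<noteq> 0} \<subseteq> cbox a c"
    by (rule closure_minimal) (rule closed_cbox)
  moreover have "C_k k (box_cutoff m a c)" for k
    unfolding box_cutoff_def by (intro C_k_prod C_k_mult C_k_exp_inv_affine)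
  moreover have "compact (closure {x. box_cutoff m a c x \<noteq> 0})"
    using cl by (meson bounded_cbox bounded_subset closed_closure compact_eq_bounded_closed)
  ultimately show ?thesis using assms by (auto simp: test_functions_def)
qed

section \<open>The fundamental lemma of the calculus of variations\<close>

text \<open>By Lebesgue differentiation, f is almost everywhere the limit of its averages over small
  cubes, and all those averages are zero.\<close>

lemma AE_zero_if_box_integrals_zero:
  fixes f :: "'a::euclidean_space \<Rightarrow> real"
  assumes f: "set_integrable lebesgue (cbox a c) f"
    and zero: "\<And>u v. cbox u v \<subseteq> box a c \<Longrightarrow> integral (cbox u v) f = 0"
  shows "AE x in lebesgue. x \<in> box a c \<longrightarrow> f x = 0"
proof -
  \<comment> \<open>Extension by zero makes the function integrable over every box, as the
    differentiation theorem requires.\<close>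
  define g where "g x = (if x \<in> cbox a c then f x else 0)" for x
  have "set_integrable lebesgue UNIV g"
  proof -
    have "(\<lambda>x. indicator UNIV x *\<^sub>R g x) = (\<lambda>x. indicator (cbox a c) x *\<^sub>R f x)"
      by (auto simp: g_def indicator_def)
    then show ?thesis using f by (simp add: set_integrable_def)
  qed
  then have "g integrable_on UNIV" by (rule set_lebesgue_integral_eq_integral(1))
  then have "g integrable_on cbox u v" for u v
    using integrable_on_subcbox by blast
  then obtain N where N: "negligible N" and lim: "\<And>x e. \<lbrakk>x \<notin> N; 0 < e\<rbrakk> \<Longrightarrow> \<exists>d>0. \<forall>h. 0 < h \<and> h < d \<longrightarrow>
      norm (integral (cbox x (x + h *\<^sub>R One)) g /\<^sub>R h ^ DIM('a) - g x) < e"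
    using integrable_ccontinuous_explicit by blast
  have "f x = 0" if x: "x \<in> box a c" "x \<notin> N" for x
  proof (rule ccontr)
    assume "f x \<noteq> 0"
    then have gx: "\<bar>g x\<bar> > 0" using x(1) box_subset_cbox by (auto simp: g_def)
    obtain d where d: "d > 0" "\<And>h. \<lbrakk>0 < h; h < d\<rbrakk> \<Longrightarrow>
        norm (integral (cbox x (x + h *\<^sub>R One)) g /\<^sub>R h ^ DIM('a) - g x) < \<bar>g x\<bar>"
      using lim[OF x(2) gx] by blast
    obtain r where r: "r > 0" "ball x r \<subseteq> box a c"
      using x(1) open_box open_contains_ball by blast
    \<comment> \<open>A point of the cube differs from x by at most h in each coordinate, so by at
      most \<open>h * DIM('a) < r\<close> in norm, and the cube stays inside the ball.\<close>
    define h where "h = min (d / 2) (r / (2 * DIM('a)))"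
    have h: "0 < h" "h < d" "h * DIM('a) < r"
      using d(1) r(1) by (auto simp: h_def min_def field_simps)
    have sub: "cbox x (x + h *\<^sub>R One) \<subseteq> box a c"
    proof
      fix y assume y: "y \<in> cbox x (x + h *\<^sub>R One)"
      have "norm (x - y) \<le> (\<Sum>b\<in>Basis. \<bar>(x - y) \<bullet> b\<bar>)" by (rule norm_le_l1)
      also have "\<dots> \<le> (\<Sum>b\<in>(Basis::'a set). h)"
        using y by (intro sum_mono) (auto simp: mem_box inner_diff_left inner_add_left abs_le_iff)
      also have "\<dots> = h * DIM('a)" by simp
      finally show "y \<in> box a c" using h(3) r(2) by (auto simp: dist_norm)
    qed
    have "integral (cbox x (x + h *\<^sub>R One)) g = integral (cbox x (x + h *\<^sub>R One)) f"
      using sub box_subset_cbox by (intro integral_cong) (auto simp: g_def)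
    with zero[OF sub] d(2)[OF h(1,2)] show False by simp
  qed
  then have "{x. \<not> (x \<in> box a c \<longrightarrow> f x = 0)} \<subseteq> N" by blast
  then show ?thesis
    using N by (intro AE_I'[of N]) (auto simp: negligible_iff_null_sets)
qed

text \<open>The compact support K of g turns local integrability into integrability of
  \<open>indicator K x * f x\<close> on the whole space, where dominated convergence can be
  applied.\<close>

lemma locally_integrable_mult_cutoff:
  fixes f :: "'a::euclidean_space \<Rightarrow> real"
  assumes f: "locally_integrable_on f \<Omega>" and \<Omega>: "\<Omega> \<in> sets lebesgue" and K: "compact K" "K \<subseteq> \<Omega>"
    and g: "g \<in> borel_measurable lebesgue" "\<And>x. \<bar>g x\<bar> \<le> B" "\<And>x. x \<notin> K \<Longrightarrow> g x = 0"
  shows "integrable (lebesgue_on \<Omega>) (\<lambda>x. f x * g x)"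
    and "(LINT x|lebesgue_on \<Omega>. f x * g x) = (LINT x|lebesgue. (indicator K x * f x) * g x)"
proof -
  have eq: "(\<lambda>x. indicator \<Omega> x *\<^sub>R (f x * g x)) = (\<lambda>x. (indicator K x * f x) * g x)"
  proof
    fix x
    show "indicator \<Omega> x *\<^sub>R (f x * g x) = (indicator K x * f x) * g x"
      using K(2) g(3)[of x] by (cases "x \<in> K") (auto simp: indicator_def)
  qed
  have fK: "integrable lebesgue (\<lambda>x. indicator K x * f x)"
    using f K by (auto simp: locally_integrable_on_def set_integrable_def)
  have "integrable lebesgue (\<lambda>x. (indicator K x * f x) * g x)"
  proof (rule Bochner_Integration.integrable_bound[OF integrable_mult_right[OF fK, of B]])
    show "(\<lambda>x. (indicator K x * f x) * g x) \<in> borel_measurable lebesgue"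
      using borel_measurable_integrable[OF fK] g(1) by measurable
    show "AE x in lebesgue. norm (indicator K x * f x * g x) \<le> norm (B * (indicator K x * f x))"
    proof (rule AE_I2)
      fix x
      have "\<bar>g x\<bar> \<le> \<bar>B\<bar>" using g(2)[of x] by linarith
      then show "norm (indicator K x * f x * g x) \<le> norm (B * (indicator K x * f x))"
        unfolding real_norm_def abs_mult[of _ "g x"] abs_mult[of B]
        by (subst mult.commute) (intro mult_right_mono abs_ge_zero)
    qed
  qed
  then show "integrable (lebesgue_on \<Omega>) (\<lambda>x. f x * g x)"
    "(LINT x|lebesgue_on \<Omega>. f x * g x) = (LINT x|lebesgue. (indicator K x * f x) * g x)"
    using \<Omega> by (simp_all only: integrable_restrict_space integral_restrict_space eq Int_UNIV_right space_completion space_lborel space_borel)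
qed

lemma C_k_continuous: "C_k k f \<Longrightarrow> continuous_on UNIV f"
  by (cases k) (auto simp: continuous_on_eq_continuous_at intro: differentiable_imp_continuous_within)

lemma test_functions_continuous: "\<phi> \<in> test_functions \<Omega> \<Longrightarrow> continuous_on UNIV \<phi>"
  using C_k_continuous[of 0 \<phi>] by (simp add: test_functions_def)

text \<open>The cut-offs of a box are admissible test functions and converge boundedly to its
  indicator. Hence all integrals of h over boxes in \<Omega> vanish, and differentiation gives the
  claim box by box.\<close>

lemma fundamental_lemma:
  fixes h :: "'a::euclidean_space \<Rightarrow> real"
  assumes \<Omega>: "open \<Omega>" and h: "locally_integrable_on h \<Omega>"
    and zero: "\<And>\<phi>. \<phi> \<in> test_functions \<Omega> \<Longrightarrow> (LINT x|lebesgue_on \<Omega>. h x * \<phi> x) = 0"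
  shows "AE x in lebesgue_on \<Omega>. h x = 0"
proof -
  have \<Omega>l: "\<Omega> \<in> sets lebesgue" using \<Omega> by auto
  have box0: "integral (cbox u v) h = 0" if "cbox u v \<subseteq> \<Omega>" for u v
  proof -
    have hi: "set_integrable lebesgue (cbox u v) h"
      using h that by (auto simp: locally_integrable_on_def)
    then have hK: "integrable lebesgue (\<lambda>x. indicator (cbox u v) x * h x)"
      by (simp add: set_integrable_def)
    have cm: "box_cutoff m u v \<in> borel_measurable lebesgue" for m
      using test_functions_continuous[OF box_cutoff_test[OF subset_UNIV, of m u v]]
      by (simp add: borel_measurable_continuous_onI measurable_completion)
    have "(LINT x|lebesgue. (indicator (cbox u v) x * h x) * box_cutoff m u v x) = 0" for m
    proof -
      have "(LINT x|lebesgue_on \<Omega>. h x * box_cutoff m u v x)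
          = (LINT x|lebesgue. (indicator (cbox u v) x * h x) * box_cutoff m u v x)"
      proof (rule locally_integrable_mult_cutoff(2)[OF h \<Omega>l compact_cbox that cm])
        show "\<bar>box_cutoff m u v x\<bar> \<le> 1" for x
          using box_cutoff_bounds[of m u v x] by simp
        show "box_cutoff m u v x = 0" if "x \<notin> cbox u v" for x
          using that box_cutoff_eq_0 box_subset_cbox by blast
      qed
      then show ?thesis using zero[OF box_cutoff_test[OF that]] by simp
    qed
    moreover have "(\<lambda>m. LINT x|lebesgue. (indicator (cbox u v) x * h x) * box_cutoff m u v x)
        \<longlonglongrightarrow> (LINT x|lebesgue. (indicator (cbox u v) x * h x) * indicator (box u v) x)"
    proof (rule integral_dominated_convergence[where w = "\<lambda>x. norm (indicator (cbox u v) x * h x)"])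
      show "integrable lebesgue (\<lambda>x. norm (indicator (cbox u v) x * h x))"
        using hK by (rule integrable_norm)
      show "(\<lambda>x. indicator (cbox u v) x * h x * indicator (box u v) x) \<in> borel_measurable lebesgue"
        by (intro borel_measurable_times borel_measurable_integrable[OF hK] borel_measurable_indicator) auto
      show "(\<lambda>x. indicator (cbox u v) x * h x * box_cutoff m u v x) \<in> borel_measurable lebesgue" for m
        using borel_measurable_integrable[OF hK] cm by measurable
      show "AE x in lebesgue. (\<lambda>m. indicator (cbox u v) x * h x * box_cutoff m u v x)
          \<longlonglongrightarrow> indicator (cbox u v) x * h x * indicator (box u v) x"
        by (intro AE_I2 tendsto_mult tendsto_const box_cutoff_tendsto)
      show "AE x in lebesgue. norm (indicator (cbox u v) x * h x * box_cutoff m u v x)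
          \<le> norm (indicator (cbox u v) x * h x)" for m
        using box_cutoff_bounds[of m u v] by (intro AE_I2) (simp add: abs_mult mult_left_le)
    qed
    ultimately have "(LINT x|lebesgue. (indicator (cbox u v) x * h x) * indicator (box u v) x) = 0"
      by (simp add: LIMSEQ_const_iff)
    moreover have "AE x in lebesgue. x \<notin> cbox u v - box u v"
      using negligible_frontier_interval[of u v] by (intro AE_not_in) (simp add: negligible_iff_null_sets)
    then have "AE x in lebesgue. (indicator (cbox u v) x * h x) * indicator (box u v) x = indicator (cbox u v) x *\<^sub>R h x"
      by eventually_elim (auto simp: indicator_def)
    then have "(LINT x|lebesgue. (indicator (cbox u v) x * h x) * indicator (box u v) x)
        = (LINT x:cbox u v|lebesgue. h x)"
      unfolding set_lebesgue_integral_def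
      using borel_measurable_integrable[OF hK]
      by (intro integral_cong_AE borel_measurable_times[OF borel_measurable_integrable[OF hK] borel_measurable_indicator]) auto
    ultimately show ?thesis using set_lebesgue_integral_eq_integral(2)[OF hi] by simp
  qed
  \<comment> \<open>The argument for one box reaches only its interior. The faces are null, and
    countability of the cover keeps their union null.\<close>
  obtain \<D> where D: "countable \<D>" "\<And>X. X \<in> \<D> \<Longrightarrow> X \<subseteq> \<Omega>" "\<And>X. X \<in> \<D> \<Longrightarrow> \<exists>a b. X = cbox a b" "\<Union>\<D> = \<Omega>"
    using open_countable_Union_open_cbox[OF \<Omega>] by (metis Pow_iff subsetD)
  have "AE x in lebesgue. x \<in> X \<longrightarrow> h x = 0" if X: "X \<in> \<D>" for X
  proof -
    obtain u v where uv: "X = cbox u v" using D(3)[OF X] by blast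
    have sub: "cbox u v \<subseteq> \<Omega>" using D(2)[OF X] uv by simp
    have "AE x in lebesgue. x \<in> box u v \<longrightarrow> h x = 0"
    proof (rule AE_zero_if_box_integrals_zero)
      show "set_integrable lebesgue (cbox u v) h"
        using h sub by (auto simp: locally_integrable_on_def)
      show "integral (cbox u' v') h = 0" if "cbox u' v' \<subseteq> box u v" for u' v'
        using that sub box_subset_cbox by (intro box0) blast
    qed
    moreover have "AE x in lebesgue. x \<notin> cbox u v - box u v"
      using negligible_frontier_interval[of u v] by (intro AE_not_in) (simp add: negligible_iff_null_sets)
    ultimately show ?thesis unfolding uv by eventually_elim auto
  qed
  then have "AE x in lebesgue. \<forall>X\<in>\<D>. x \<in> X \<longrightarrow> h x = 0"
    by (subst AE_ball_countable[OF D(1)]) blast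
  then have "AE x in lebesgue. x \<in> \<Omega> \<longrightarrow> h x = 0"
    by eventually_elim (use D(4) in blast)
  then show ?thesis using \<Omega>l by (simp add: AE_restrict_space_iff)
qed

section \<open>Test functions: closure properties, integrability and integration by parts\<close>

lemma test_functions_C_k: "\<phi> \<in> test_functions \<Omega> \<Longrightarrow> C_k k \<phi>"
  by (simp add: test_functions_def)

lemma test_functions_differentiable: "\<phi> \<in> test_functions \<Omega> \<Longrightarrow> \<phi> differentiable (at x)"
  using test_functions_C_k[of \<phi> \<Omega> "Suc 0"] by simp

lemma test_functions_has_derivative:
  "\<phi> \<in> test_functions \<Omega> \<Longrightarrow> (\<phi> has_derivative frechet_derivative \<phi> (at x)) (at x)"
  using test_functions_differentiable by (simp add: frechet_derivative_works)

lemma test_functionsI: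
  assumes "\<And>k. C_k k \<phi>" "compact K" "K \<subseteq> \<Omega>" "\<And>x. x \<notin> K \<Longrightarrow> \<phi> x = 0"
  shows "\<phi> \<in> test_functions \<Omega>"
proof -
  have "closure {x. \<phi> x \<noteq> 0} \<subseteq> K"
    using assms(2,4) by (intro closure_minimal) (auto intro: compact_imp_closed)
  moreover from this have "compact (closure {x. \<phi> x \<noteq> 0})"
    using compact_imp_bounded[OF assms(2)] bounded_subset compact_eq_bounded_closed by blast
  ultimately show ?thesis
    using assms unfolding test_functions_def by blast
qed

lemma test_functions_support:
  assumes "\<phi> \<in> test_functions \<Omega>"
  obtains K where "compact K" "K \<subseteq> \<Omega>" "\<And>x. x \<notin> K \<Longrightarrow> \<phi> x = 0"
    "\<And>x i. x \<notin> K \<Longrightarrow> frechet_derivative \<phi> (at x) i = 0"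
proof -
  define K where "K = closure {x. \<phi> x \<noteq> 0}"
  have z: "\<phi> x = 0" if "x \<notin> K" for x
    using that subsetD[OF closure_subset, of x "{x. \<phi> x \<noteq> 0}"] by (auto simp: K_def)
  have d: "frechet_derivative \<phi> (at x) i = 0" if x: "x \<notin> K" for x i
  proof -
    have "((\<lambda>_. 0) has_derivative (\<lambda>_. 0)) (at x)" by simp
    moreover have "open (- K)" by (simp add: K_def open_Compl)
    ultimately have "(\<phi> has_derivative (\<lambda>_. 0)) (at x)"
      by (rule has_derivative_transform_within_open) (simp_all add: x z)
    from frechet_derivative_at[OF this, symmetric] show ?thesis by simp
  qed
  show thesis
    by (rule that[OF _ _ z d]) (use assms in \<open>simp_all add: test_functions_def K_def\<close>)
qed

lemma test_functions_deriv:
  assumes \<phi>: "\<phi> \<in> test_functions \<Omega>" and i: "i \<in> Basis"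
  shows "(\<lambda>x. frechet_derivative \<phi> (at x) i) \<in> test_functions \<Omega>"
proof -
  obtain K where K: "compact K" "K \<subseteq> \<Omega>" "\<And>x. x \<notin> K \<Longrightarrow> frechet_derivative \<phi> (at x) i = 0"
    using test_functions_support[OF \<phi>] by metis
  have "C_k k (\<lambda>x. frechet_derivative \<phi> (at x) i)" for k
    using test_functions_C_k[OF \<phi>, of "Suc k"] i by simp
  with K show ?thesis by (intro test_functionsI)
qed

lemma test_functions_mult:
  assumes "\<phi> \<in> test_functions \<Omega>" "\<eta> \<in> test_functions \<Omega>'"
  shows "(\<lambda>x. \<phi> x * \<eta> x) \<in> test_functions \<Omega>"
proof -
  obtain K where K: "compact K" "K \<subseteq> \<Omega>" "\<And>x. x \<notin> K \<Longrightarrow> \<phi> x = 0"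
    using test_functions_support[OF assms(1)] by metis
  then show ?thesis using assms
    by (intro test_functionsI[of _ K] C_k_mult) (auto dest: test_functions_C_k)
qed

lemma test_functions_lincomb:
  assumes "\<phi> \<in> test_functions \<Omega>" "\<eta> \<in> test_functions \<Omega>"
  shows "(\<lambda>x. a * \<phi> x + b * \<eta> x) \<in> test_functions \<Omega>"
proof -
  obtain K where K: "compact K" "K \<subseteq> \<Omega>" "\<And>x. x \<notin> K \<Longrightarrow> \<phi> x = 0"
    using test_functions_support[OF assms(1)] by metis
  obtain L where L: "compact L" "L \<subseteq> \<Omega>" "\<And>x. x \<notin> L \<Longrightarrow> \<eta> x = 0"
    using test_functions_support[OF assms(2)] by metis
  from K L assms show ?thesis
    by (intro test_functionsI[of _ "K \<union> L"] C_k_add C_k_mult C_k_const) (auto dest: test_functions_C_k)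
qed

lemma test_functions_zero: "(\<lambda>x. 0) \<in> test_functions \<Omega>"
  by (intro test_functionsI[of _ "{}"] C_k_const) auto

lemma test_functions_bounded:
  assumes "\<phi> \<in> test_functions \<Omega>"
  obtains B where "B \<ge> 0" "\<And>x. \<bar>\<phi> x\<bar> \<le> B"
proof -
  obtain K where K: "compact K" "K \<subseteq> \<Omega>" "\<And>x. x \<notin> K \<Longrightarrow> \<phi> x = 0"
    using test_functions_support[OF assms] by metis
  have "compact (\<phi> ` K)"
    using K(1) test_functions_continuous[OF assms] continuous_on_subset
    by (intro compact_continuous_image) blast+
  then obtain B where B: "\<forall>y\<in>\<phi> ` K. norm y \<le> B" using compact_imp_bounded bounded_iff by blast
  have "\<bar>\<phi> x\<bar> \<le> max B 0" for x
    using B K(3)[of x] by (cases "x \<in> K") force+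
  then show thesis using that[of "max B 0"] by simp
qed

lemma test_functions_borel: "\<phi> \<in> test_functions \<Omega> \<Longrightarrow> \<phi> \<in> borel_measurable borel"
  using test_functions_continuous borel_measurable_continuous_onI by blast

lemma test_functions_lebesgue: "\<phi> \<in> test_functions \<Omega> \<Longrightarrow> \<phi> \<in> borel_measurable lebesgue"
  by (intro measurable_completion) (simp add: test_functions_borel)

lemma integrable_compact_support:
  fixes f :: "'a::euclidean_space \<Rightarrow> real"
  assumes "f \<in> borel_measurable lebesgue" "compact K" "\<And>x. x \<notin> K \<Longrightarrow> f x = 0" "\<And>x. \<bar>f x\<bar> \<le> B"
  shows "integrable lebesgue f"
proof (rule Bochner_Integration.integrable_bound)
  have "K \<in> lmeasurable" using assms(2) lmeasurable_compact by blast
  then show "integrable lebesgue (\<lambda>x. B * indicator K x)"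
    by (intro integrable_mult_right) (simp add: lmeasurable_iff_integrable)
  show "AE x in lebesgue. norm (f x) \<le> norm (B * indicator K x)"
  proof (rule AE_I2)
    fix x
    have "\<bar>f x\<bar> \<le> \<bar>B\<bar>" using assms(4)[of x] by linarith
    then show "norm (f x) \<le> norm (B * indicator K x)"
      using assms(3)[of x] by (cases "x \<in> K") auto
  qed
qed (rule assms(1))

lemma test_functions_integrable:
  assumes "\<phi> \<in> test_functions \<Omega>"
  shows "integrable lebesgue \<phi>"
proof -
  obtain K where K: "compact K" "K \<subseteq> \<Omega>" "\<And>x. x \<notin> K \<Longrightarrow> \<phi> x = 0"
    using test_functions_support[OF assms] by metis
  obtain B where B: "B \<ge> 0" "\<And>x. \<bar>\<phi> x\<bar> \<le> B" using test_functions_bounded[OF assms] by metis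
  show ?thesis
    by (rule integrable_compact_support[OF test_functions_lebesgue[OF assms] K(1,3) B(2)])
qed

lemma test_functions_L2:
  assumes \<Omega>: "\<Omega> \<in> sets lebesgue" and \<phi>: "\<phi> \<in> test_functions \<Omega>'"
  shows "\<phi> \<in> L2_space \<Omega>"
proof (rule L2_space_restrict[OF \<Omega>])
  show "\<phi> \<in> L2_space UNIV"
    using test_functions_lebesgue[OF \<phi>] test_functions_integrable[OF test_functions_mult[OF \<phi> \<phi>]]
    by (simp add: L2_space_def lebesgue_on_UNIV_eq power2_eq_square)
qed

lemma integral_translation_lebesgue:
  fixes f :: "'a::euclidean_space \<Rightarrow> real"
  assumes f: "f \<in> borel_measurable borel"
  shows "(LINT x|lebesgue. f (c + x)) = (LINT x|lebesgue. f x)"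
proof -
  have "(LINT x|lebesgue. f x) = (LINT x|distr lborel borel ((+) c). f x)"
    using f by (simp add: integral_completion lborel_distr_plus)
  also have "\<dots> = (LINT x|lborel. f (c + x))"
    using f by (intro integral_distr) auto
  also have "\<dots> = (LINT x|lebesgue. f (c + x))"
    using f by (subst integral_completion) (auto intro: measurable_compose)
  finally show ?thesis by simp
qed

text \<open>Translation invariance makes the integrals of the difference quotients vanish.\<close>

lemma integral_deriv_test_function:
  fixes \<phi> :: "'a::euclidean_space \<Rightarrow> real"
  assumes \<phi>: "\<phi> \<in> test_functions \<Omega>" and i: "i \<in> Basis"
  shows "(LINT x|lebesgue. frechet_derivative \<phi> (at x) i) = 0"
proof -
  define D where "D x = frechet_derivative \<phi> (at x) i" for x
  have DT: "D \<in> test_functions \<Omega>" unfolding D_def by (rule test_functions_deriv[OF \<phi> i])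
  obtain B where B: "B \<ge> 0" "\<And>x. \<bar>D x\<bar> \<le> B" using test_functions_bounded[OF DT] by metis
  obtain K where K: "compact K" "\<And>x. x \<notin> K \<Longrightarrow> \<phi> x = 0"
    using test_functions_support[OF \<phi>] by metis
  obtain r where r: "\<And>x. x \<in> K \<Longrightarrow> norm x \<le> r" using K(1) compact_imp_bounded bounded_iff by metis
  have line: "((\<lambda>t. \<phi> (t *\<^sub>R i + x)) has_real_derivative D (t *\<^sub>R i + x)) (at t)" for t x
  proof -
    have "((\<lambda>t. t *\<^sub>R i + x) has_derivative (\<lambda>t. t *\<^sub>R i)) (at t)"
      by (auto intro!: derivative_eq_intros)
    from has_derivative_compose[OF this test_functions_has_derivative[OF \<phi>]]
    have "((\<lambda>t. \<phi> (t *\<^sub>R i + x)) has_derivative (\<lambda>s. frechet_derivative \<phi> (at (t *\<^sub>R i + x)) (s *\<^sub>R i))) (at t)" .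
    moreover have "frechet_derivative \<phi> (at y) (s *\<^sub>R i) = D y * s" for s y
      using linear_scale[OF linear_frechet_derivative[OF test_functions_differentiable[OF \<phi>]]]
      by (simp add: D_def mult.commute)
    ultimately show ?thesis by (simp add: has_field_derivative_def)
  qed
  define q where "q n x = real (Suc n) * (\<phi> ((1 / real (Suc n)) *\<^sub>R i + x) - \<phi> x)" for n x
  \<comment> \<open>The mean value theorem along direction i bounds every difference quotient by the
    supremum of the derivative, uniformly in n.\<close>
  have q_bound: "\<bar>q n x\<bar> \<le> B" for n x
  proof -
    obtain z where z: "\<phi> ((1 / real (Suc n)) *\<^sub>R i + x) - \<phi> (0 *\<^sub>R i + x)
        = (1 / real (Suc n) - 0) * D (z *\<^sub>R i + x)"
      using MVT2[of 0 "1 / real (Suc n)" "\<lambda>t. \<phi> (t *\<^sub>R i + x)" "\<lambda>t. D (t *\<^sub>R i + x)"] line by auto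
    then have "q n x = D (z *\<^sub>R i + x)" by (simp add: q_def)
    then show ?thesis using B(2) by simp
  qed
  \<comment> \<open>A shift has length at most 1, so the enlarged ball contains the supports of all
    quotients. With \<open>q_bound\<close> this gives the dominating function.\<close>
  have q_supp: "q n x = 0" if "x \<notin> cball 0 (r + 1)" for n x
  proof -
    define v where "v = (1 / real (Suc n)) *\<^sub>R i"
    have "norm v \<le> 1" using i by (simp add: v_def)
    moreover have "norm x > r + 1" using that by simp
    moreover have "norm x - norm v \<le> norm (v + x)"
      using norm_triangle_ineq2[of x "- v"] by (simp add: add.commute)
    ultimately have "\<not> norm x \<le> r" "\<not> norm (v + x) \<le> r" by linarith+
    then have "x \<notin> K" "v + x \<notin> K" using r by blast+
    then show ?thesis by (simp add: q_def K(2) v_def[symmetric] del: of_nat_Suc)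
  qed
  have tb: "(\<lambda>x. \<phi> (c + x)) \<in> borel_measurable borel" for c
    using test_functions_borel[OF \<phi>] by (auto intro: measurable_compose)
  have q_meas: "q n \<in> borel_measurable lebesgue" for n
    unfolding q_def using tb[of "(1 / real (Suc n)) *\<^sub>R i"] test_functions_borel[OF \<phi>]
    by (intro measurable_completion borel_measurable_times borel_measurable_diff) auto
  have q0: "(LINT x|lebesgue. q n x) = 0" for n
  proof -
    let ?c = "(1 / real (Suc n)) *\<^sub>R i"
    have "\<phi> (?c + x) = q n x / real (Suc n) + \<phi> x" for x by (simp add: q_def)
    moreover have "integrable lebesgue (q n)"
      by (rule integrable_compact_support[OF q_meas compact_cball q_supp q_bound])
    ultimately have "(LINT x|lebesgue. \<phi> (?c + x)) = (LINT x|lebesgue. q n x) / real (Suc n) + (LINT x|lebesgue. \<phi> x)"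
      using test_functions_integrable[OF \<phi>] by simp
    then show ?thesis
      using integral_translation_lebesgue[OF test_functions_borel[OF \<phi>], of ?c] by simp
  qed
  have "(\<lambda>n. LINT x|lebesgue. q n x) \<longlonglongrightarrow> (LINT x|lebesgue. D x)"
  proof (rule integral_dominated_convergence[where w = "\<lambda>x. B * indicator (cball 0 (r + 1)) x"])
    show "D \<in> borel_measurable lebesgue" by (rule test_functions_lebesgue[OF DT])
    show "q n \<in> borel_measurable lebesgue" for n by (rule q_meas)
    show "integrable lebesgue (\<lambda>x. B * indicator (cball (0::'a) (r + 1)) x)"
      by (intro integrable_mult_right) (simp add: lmeasurable_iff_integrable[symmetric])
    show "AE x in lebesgue. norm (q n x) \<le> B * indicator (cball 0 (r + 1)) x" for n
      using q_bound q_supp by (intro AE_I2) (auto simp: indicator_def)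
    show "AE x in lebesgue. (\<lambda>n. q n x) \<longlonglongrightarrow> D x"
    proof (rule AE_I2)
      fix x
      have "(\<lambda>t. (\<phi> (t *\<^sub>R i + x) - \<phi> x) / t) \<midarrow>0\<rightarrow> D x"
        using line[of x 0] by (simp add: has_field_derivative_iff)
      moreover have "filterlim (\<lambda>n. 1 / real (Suc n)) (at 0) sequentially"
        unfolding filterlim_at using LIMSEQ_inverse_real_of_nat by (simp add: inverse_eq_divide)
      ultimately have "(\<lambda>n. (\<phi> ((1 / real (Suc n)) *\<^sub>R i + x) - \<phi> x) / (1 / real (Suc n))) \<longlonglongrightarrow> D x"
        by (rule filterlim_compose)
      then show "(\<lambda>n. q n x) \<longlonglongrightarrow> D x" by (simp add: q_def mult.commute)
    qed
  qed
  then show ?thesis using q0 by (simp add: LIMSEQ_const_iff D_def)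
qed

text \<open>The product is again a test function, so the integral of its derivative vanishes; the
  Leibniz rule splits it.\<close>

lemma test_functions_by_parts:
  fixes \<phi> \<eta> :: "'a::euclidean_space \<Rightarrow> real"
  assumes \<phi>: "\<phi> \<in> test_functions \<Omega>" and \<eta>: "\<eta> \<in> test_functions \<Omega>'" and i: "i \<in> Basis"
  shows "(LINT x|lebesgue. \<phi> x * frechet_derivative \<eta> (at x) i)
    = - (LINT x|lebesgue. frechet_derivative \<phi> (at x) i * \<eta> x)"
proof -
  have "frechet_derivative (\<lambda>x. \<phi> x * \<eta> x) (at x) i
      = \<phi> x * frechet_derivative \<eta> (at x) i + frechet_derivative \<phi> (at x) i * \<eta> x" for x
    using has_derivative_mult[OF test_functions_has_derivative[OF \<phi>] test_functions_has_derivative[OF \<eta>],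
        THEN frechet_derivative_at, THEN sym] by simp
  then have "(LINT x|lebesgue. \<phi> x * frechet_derivative \<eta> (at x) i + frechet_derivative \<phi> (at x) i * \<eta> x) = 0"
    using integral_deriv_test_function[OF test_functions_mult[OF \<phi> \<eta>] i] by simp
  moreover have "integrable lebesgue (\<lambda>x. \<phi> x * frechet_derivative \<eta> (at x) i)"
    by (rule test_functions_integrable[OF test_functions_mult[OF \<phi> test_functions_deriv[OF \<eta> i]]])
  moreover have "integrable lebesgue (\<lambda>x. frechet_derivative \<phi> (at x) i * \<eta> x)"
    by (rule test_functions_integrable[OF test_functions_mult[OF test_functions_deriv[OF \<phi> i] \<eta>]])
  ultimately show ?thesis by simp
qed

section \<open>Weak gradients and the Sobolev spaces\<close>

text \<open>On a compact set, which has finite measure, \<open>norm y \<le> 1 + (norm y)^2\<close>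
  reduces integrability to square integrability. It supplies the side conditions of
  \<open>has_weak_grad\<close> for all L2 functions.\<close>

lemma L2_locally_integrable:
  assumes \<Omega>: "\<Omega> \<in> sets lebesgue" and f: "f \<in> L2_space \<Omega>"
  shows "locally_integrable_on f \<Omega>"
  unfolding locally_integrable_on_def set_integrable_def
proof (intro allI impI, elim conjE)
  fix K assume K: "compact K" "K \<subseteq> \<Omega>"
  let ?f = "\<lambda>x. indicator \<Omega> x *\<^sub>R f x"
  have fL: "?f \<in> L2_space UNIV" by (rule L2_space_indicator[OF \<Omega> f])
  have Kl: "K \<in> lmeasurable" using K(1) lmeasurable_compact by blast
  have eq: "(\<lambda>x. indicator K x *\<^sub>R f x) = (\<lambda>x. indicator K x *\<^sub>R ?f x)"
    by (intro ext) (use K(2) in \<open>auto simp: indicator_def\<close>)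
  show "integrable lebesgue (\<lambda>x. indicator K x *\<^sub>R f x)"
    unfolding eq
  proof (rule Bochner_Integration.integrable_bound)
    show "integrable lebesgue (\<lambda>x. indicator K x + (norm (?f x))\<^sup>2)"
      using Kl L2_spaceD(2)[OF fL] by (intro Bochner_Integration.integrable_add)
        (simp_all only: lmeasurable_iff_integrable lebesgue_on_UNIV_eq)
    show "(\<lambda>x. indicator K x *\<^sub>R ?f x) \<in> borel_measurable lebesgue"
      using L2_spaceD(1)[OF fL] unfolding lebesgue_on_UNIV_eq
      by (rule borel_measurable_scaleR[OF borel_measurable_indicator[OF fmeasurableD[OF Kl]]])
    have "norm y \<le> 1 + (norm y)\<^sup>2" for y :: 'b
      using zero_le_power2[of "norm y - 1"] norm_ge_zero[of y] unfolding power2_diff power_one mult_1_right by linarith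
    then show "AE x in lebesgue. norm (indicator K x *\<^sub>R ?f x) \<le> norm (indicator K x + (norm (?f x))\<^sup>2)"
      by (intro AE_I2) (auto simp: indicator_def)
  qed
qed

definition grad :: "('a::euclidean_space \<Rightarrow> real) \<Rightarrow> 'a \<Rightarrow> 'a" where
  "grad \<phi> x = (\<Sum>i\<in>Basis. frechet_derivative \<phi> (at x) i *\<^sub>R i)"

lemma grad_inner_Basis: "i \<in> Basis \<Longrightarrow> grad \<phi> x \<bullet> i = frechet_derivative \<phi> (at x) i"
  by (simp add: grad_def inner_sum_left inner_Basis if_distrib sum.delta cong: if_cong)

lemma L2_space_sum:
  "finite I \<Longrightarrow> (\<And>i. i \<in> I \<Longrightarrow> f i \<in> L2_space \<Omega>) \<Longrightarrow> (\<lambda>x. \<Sum>i\<in>I. f i x) \<in> L2_space \<Omega>"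
  by (induction I rule: finite_induct) (simp_all add: L2_space_zero L2_space_add)

lemma L2_space_scaleR_const:
  fixes f :: "'a::euclidean_space \<Rightarrow> real"
  assumes "f \<in> L2_space \<Omega>"
  shows "(\<lambda>x. f x *\<^sub>R v) \<in> L2_space \<Omega>"
  using L2_spaceD(1)[OF assms]
  by (intro L2_space_bound[OF _ assms, of _ "norm v"]) (auto simp: mult.commute)

lemma grad_test_function_L2:
  assumes "\<Omega> \<in> sets lebesgue" "\<phi> \<in> test_functions \<Omega>'"
  shows "grad \<phi> \<in> L2_space \<Omega>"
  unfolding grad_def
  by (intro L2_space_sum finite_Basis L2_space_scaleR_const
      test_functions_L2[OF assms(1) test_functions_deriv[OF assms(2)]])

lemma integral_restrict_test:
  fixes f :: "'a::euclidean_space \<Rightarrow> real"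
  assumes "\<Omega> \<in> sets lebesgue" "\<And>x. x \<notin> \<Omega> \<Longrightarrow> f x = 0"
  shows "(LINT x|lebesgue_on \<Omega>. f x) = (LINT x|lebesgue. f x)"
proof -
  have "(\<lambda>x. indicator \<Omega> x *\<^sub>R f x) = f"
    by (intro ext) (use assms(2) in \<open>auto simp: indicator_def\<close>)
  then show ?thesis using assms(1) by (simp add: integral_restrict_space)
qed

text \<open>This puts the test functions into H1 and so gives \<open>H1_norm\<close> its meaning for
  the differences that occur in \<open>H10\<close>.\<close>

lemma has_weak_grad_test_function:
  assumes \<Omega>: "\<Omega> \<in> sets lebesgue" and \<phi>: "\<phi> \<in> test_functions \<Omega>"
  shows "has_weak_grad \<Omega> \<phi> (grad \<phi>)"
  unfolding has_weak_grad_def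
proof (intro conjI ballI)
  show "locally_integrable_on \<phi> \<Omega>" "locally_integrable_on (grad \<phi>) \<Omega>"
    using \<phi> \<Omega> by (auto intro: L2_locally_integrable test_functions_L2 grad_test_function_L2)
  fix \<eta> :: "'a \<Rightarrow> real" and i :: 'a assume \<eta>: "\<eta> \<in> test_functions \<Omega>" and i: "i \<in> Basis"
  obtain K where K: "K \<subseteq> \<Omega>" "\<And>x. x \<notin> K \<Longrightarrow> \<eta> x = 0" "\<And>x i. x \<notin> K \<Longrightarrow> frechet_derivative \<eta> (at x) i = 0"
    using test_functions_support[OF \<eta>] by metis
  have "\<eta> x = 0" "frechet_derivative \<eta> (at x) i = 0" if "x \<notin> \<Omega>" for x
    using that K by blast+
  then show "(LINT x|lebesgue_on \<Omega>. \<phi> x * frechet_derivative \<eta> (at x) i)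
      = - (LINT x|lebesgue_on \<Omega>. grad \<phi> x \<bullet> i * \<eta> x)"
    using test_functions_by_parts[OF \<phi> \<eta> i] by (simp add: integral_restrict_test[OF \<Omega>] grad_inner_Basis[OF i])
qed

lemma locally_integrable_on_linear:
  assumes "locally_integrable_on f \<Omega>" "bounded_linear T"
  shows "locally_integrable_on (\<lambda>x. T (f x)) \<Omega>"
  unfolding locally_integrable_on_def set_integrable_def
proof (intro allI impI)
  fix K assume "compact K \<and> K \<subseteq> \<Omega>"
  then have "integrable lebesgue (\<lambda>x. T (indicator K x *\<^sub>R f x))"
    using assms(1) unfolding locally_integrable_on_def set_integrable_def
    by (intro integrable_bounded_linear[OF assms(2)]) blast
  then show "integrable lebesgue (\<lambda>x. indicator K x *\<^sub>R T (f x))"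
    by (simp only: linear_simps(5)[OF assms(2)])
qed

lemma locally_integrable_on_add:
  assumes "locally_integrable_on f \<Omega>" "locally_integrable_on g \<Omega>"
  shows "locally_integrable_on (\<lambda>x. f x + g x) \<Omega>"
  using assms unfolding locally_integrable_on_def
  by (intro allI impI set_integral_add(1)) blast+

lemma locally_integrable_mult_test:
  fixes f :: "'a::euclidean_space \<Rightarrow> real"
  assumes f: "locally_integrable_on f \<Omega>" and \<Omega>: "\<Omega> \<in> sets lebesgue" and \<phi>: "\<phi> \<in> test_functions \<Omega>"
  shows "integrable (lebesgue_on \<Omega>) (\<lambda>x. f x * \<phi> x)"
proof -
  obtain K where K: "compact K" "K \<subseteq> \<Omega>" "\<And>x. x \<notin> K \<Longrightarrow> \<phi> x = 0"
    using test_functions_support[OF \<phi>] by metis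
  obtain B where B: "\<And>x. \<bar>\<phi> x\<bar> \<le> B" using test_functions_bounded[OF \<phi>] by metis
  show ?thesis
    by (rule locally_integrable_mult_cutoff(1)[OF f \<Omega> K(1,2) test_functions_lebesgue[OF \<phi>] B K(3)])
qed

lemma has_weak_grad_lincomb:
  assumes \<Omega>: "\<Omega> \<in> sets lebesgue" and u: "has_weak_grad \<Omega> u G" and v: "has_weak_grad \<Omega> v H"
  shows "has_weak_grad \<Omega> (\<lambda>x. a * u x + b * v x) (\<lambda>x. a *\<^sub>R G x + b *\<^sub>R H x)"
  unfolding has_weak_grad_def
proof (intro conjI ballI)
  have loc: "locally_integrable_on u \<Omega>" "locally_integrable_on v \<Omega>"
    "locally_integrable_on G \<Omega>" "locally_integrable_on H \<Omega>"
    using u v by (auto simp: has_weak_grad_def)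
  show "locally_integrable_on (\<lambda>x. a * u x + b * v x) \<Omega>"
    "locally_integrable_on (\<lambda>x. a *\<^sub>R G x + b *\<^sub>R H x) \<Omega>"
    by (rule locally_integrable_on_add[OF
          locally_integrable_on_linear[OF loc(1) bounded_linear_mult_right]
          locally_integrable_on_linear[OF loc(2) bounded_linear_mult_right]],
        rule locally_integrable_on_add[OF
          locally_integrable_on_linear[OF loc(3) bounded_linear_scaleR_right]
          locally_integrable_on_linear[OF loc(4) bounded_linear_scaleR_right]])
  fix \<phi> :: "'a \<Rightarrow> real" and i :: 'a assume \<phi>: "\<phi> \<in> test_functions \<Omega>" and i: "i \<in> Basis"
  have e: "(LINT x|lebesgue_on \<Omega>. u x * frechet_derivative \<phi> (at x) i) = - (LINT x|lebesgue_on \<Omega>. (G x \<bullet> i) * \<phi> x)"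
    "(LINT x|lebesgue_on \<Omega>. v x * frechet_derivative \<phi> (at x) i) = - (LINT x|lebesgue_on \<Omega>. (H x \<bullet> i) * \<phi> x)"
    using u v \<phi> i by (auto simp: has_weak_grad_def)
  note D = test_functions_deriv[OF \<phi> i]
  note int = locally_integrable_mult_test[OF loc(1) \<Omega> D] locally_integrable_mult_test[OF loc(2) \<Omega> D]
    locally_integrable_mult_test[OF locally_integrable_on_linear[OF loc(3) bounded_linear_inner_left] \<Omega> \<phi>, of i]
    locally_integrable_mult_test[OF locally_integrable_on_linear[OF loc(4) bounded_linear_inner_left] \<Omega> \<phi>, of i]
  have "(\<lambda>x. (a * u x + b * v x) * frechet_derivative \<phi> (at x) i)
      = (\<lambda>x. a * (u x * frechet_derivative \<phi> (at x) i) + b * (v x * frechet_derivative \<phi> (at x) i))"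
    "(\<lambda>x. ((a *\<^sub>R G x + b *\<^sub>R H x) \<bullet> i) * \<phi> x) = (\<lambda>x. a * ((G x \<bullet> i) * \<phi> x) + b * ((H x \<bullet> i) * \<phi> x))"
    by (auto simp: algebra_simps)
  then show "(LINT x|lebesgue_on \<Omega>. (a * u x + b * v x) * frechet_derivative \<phi> (at x) i)
      = - (LINT x|lebesgue_on \<Omega>. ((a *\<^sub>R G x + b *\<^sub>R H x) \<bullet> i) * \<phi> x)"
    using int e by simp
qed

text \<open>The difference is a weak gradient of the zero function, so each of its components
  integrates to zero against every test function.\<close>

lemma has_weak_grad_unique:
  assumes \<Omega>: "open \<Omega>" and G: "has_weak_grad \<Omega> u G" and H: "has_weak_grad \<Omega> u H"
  shows "AE x in lebesgue_on \<Omega>. G x = H x"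
proof -
  have \<Omega>l: "\<Omega> \<in> sets lebesgue" using \<Omega> by auto
  have D: "has_weak_grad \<Omega> (\<lambda>x. 0) (\<lambda>x. G x - H x)"
    using has_weak_grad_lincomb[OF \<Omega>l G H, of 1 "-1"] by simp
  have "AE x in lebesgue_on \<Omega>. (G x - H x) \<bullet> i = 0" if i: "i \<in> Basis" for i
  proof (rule fundamental_lemma[OF \<Omega>])
    show "locally_integrable_on (\<lambda>x. (G x - H x) \<bullet> i) \<Omega>"
      using D by (intro locally_integrable_on_linear[OF _ bounded_linear_inner_left]) (simp add: has_weak_grad_def)
    show "(LINT x|lebesgue_on \<Omega>. (G x - H x) \<bullet> i * \<phi> x) = 0" if "\<phi> \<in> test_functions \<Omega>" for \<phi>
      using D i that by (auto simp: has_weak_grad_def)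
  qed
  then have "AE x in lebesgue_on \<Omega>. \<forall>i\<in>Basis. (G x - H x) \<bullet> i = 0"
    by (intro AE_finite_allI) auto
  then show ?thesis
    by eventually_elim (auto intro: euclidean_eqI simp: inner_diff_left)
qed

text \<open>Inner products with fixed elements are continuous in the pair, so in this form being a
  weak gradient survives limits in L2.\<close>

lemma has_weak_grad_iff_inner:
  assumes \<Omega>: "\<Omega> \<in> sets lebesgue" and u: "u \<in> L2_space \<Omega>" and G: "G \<in> L2_space \<Omega>"
  shows "has_weak_grad \<Omega> u G \<longleftrightarrow> (\<forall>\<phi>\<in>test_functions \<Omega>. \<forall>i\<in>Basis.
    L2_of \<Omega> u \<bullet> L2_of \<Omega> (\<lambda>x. frechet_derivative \<phi> (at x) i) = - (L2_of \<Omega> G \<bullet> L2_of \<Omega> (\<lambda>x. \<phi> x *\<^sub>R i)))"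
proof -
  have "L2_of \<Omega> u \<bullet> L2_of \<Omega> (\<lambda>x. frechet_derivative \<phi> (at x) i) = (LINT x|lebesgue_on \<Omega>. u x * frechet_derivative \<phi> (at x) i)"
    "L2_of \<Omega> G \<bullet> L2_of \<Omega> (\<lambda>x. \<phi> x *\<^sub>R i) = (LINT x|lebesgue_on \<Omega>. (G x \<bullet> i) * \<phi> x)"
    if t: "\<phi> \<in> test_functions \<Omega>" "i \<in> Basis" for \<phi> i
    using test_functions_L2[OF \<Omega> t(1)] test_functions_L2[OF \<Omega> test_functions_deriv[OF t]]
    by (simp_all add: inner_L2_of[OF \<Omega> u] inner_L2_of[OF \<Omega> G] L2_space_scaleR_const mult.commute)
  then show ?thesis
    using L2_locally_integrable[OF \<Omega> u] L2_locally_integrable[OF \<Omega> G] by (simp add: has_weak_grad_def)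
qed

text \<open>Lebesgue measure is complete. This is needed because the chosen \<open>wgrad\<close> is
  only known to agree almost everywhere with a measurable function.\<close>

lemma borel_measurable_AE_lebesgue_on:
  fixes f g :: "'a::euclidean_space \<Rightarrow> 'b::euclidean_space"
  assumes \<Omega>: "\<Omega> \<in> sets lebesgue" and f: "f \<in> borel_measurable (lebesgue_on \<Omega>)"
    and eq: "AE x in lebesgue_on \<Omega>. f x = g x"
  shows "g \<in> borel_measurable (lebesgue_on \<Omega>)"
proof -
  have "(\<lambda>x. indicator \<Omega> x *\<^sub>R g x) \<in> borel_measurable lebesgue"
  proof (rule borel_measurable_AE)
    show "(\<lambda>x. indicator \<Omega> x *\<^sub>R f x) \<in> borel_measurable lebesgue"
      using f \<Omega> by (simp add: borel_measurable_restrict_space_iff)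
    show "AE x in lebesgue. indicator \<Omega> x *\<^sub>R f x = indicator \<Omega> x *\<^sub>R g x"
      using eq \<Omega> by (auto simp: AE_restrict_space_iff indicator_def elim!: eventually_mono)
  qed
  then show ?thesis using \<Omega> by (simp add: borel_measurable_restrict_space_iff)
qed

section \<open>The chosen gradient and the embedding of H1\<close>

lemma wgrad_AE_eq:
  assumes \<Omega>: "open \<Omega>" and G: "has_weak_grad \<Omega> u G"
  shows "has_weak_grad \<Omega> u (wgrad \<Omega> u)" "AE x in lebesgue_on \<Omega>. G x = wgrad \<Omega> u x"
proof -
  show w: "has_weak_grad \<Omega> u (wgrad \<Omega> u)" unfolding wgrad_def by (rule someI[of "has_weak_grad \<Omega> u", OF G])
  show "AE x in lebesgue_on \<Omega>. G x = wgrad \<Omega> u x" by (rule has_weak_grad_unique[OF \<Omega> G w])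
qed

lemma H1_wgrad:
  assumes \<Omega>: "open \<Omega>" and u: "u \<in> H1 \<Omega>"
  shows "u \<in> L2_space \<Omega>" "has_weak_grad \<Omega> u (wgrad \<Omega> u)" "wgrad \<Omega> u \<in> L2_space \<Omega>"
proof -
  have \<Omega>l: "\<Omega> \<in> sets lebesgue" using \<Omega> by auto
  show "u \<in> L2_space \<Omega>" using u by (simp add: H1_def)
  obtain G where G: "G \<in> L2_space \<Omega>" "has_weak_grad \<Omega> u G" using u by (auto simp: H1_def)
  show "has_weak_grad \<Omega> u (wgrad \<Omega> u)" by (rule wgrad_AE_eq(1)[OF \<Omega> G(2)])
  note eq = wgrad_AE_eq(2)[OF \<Omega> G(2)]
  show "wgrad \<Omega> u \<in> L2_space \<Omega>"
    by (rule L2_space_AE_cong[OF G(1) borel_measurable_AE_lebesgue_on[OF \<Omega>l L2_spaceD(1)[OF G(1)] eq] eq])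
qed

definition H1_embed :: "'a::euclidean_space set \<Rightarrow> ('a \<Rightarrow> real) \<Rightarrow> ('a, real) L2 \<times> ('a, 'a) L2" where
  "H1_embed \<Omega> u = (L2_of \<Omega> u, L2_of \<Omega> (wgrad \<Omega> u))"

text \<open>The embedding can be computed from any square integrable weak gradient in place of the
  chosen one, since both have the same class.\<close>

lemma H1_embed_eqI:
  assumes \<Omega>: "open \<Omega>" and u: "u \<in> L2_space \<Omega>" and G: "G \<in> L2_space \<Omega>" "has_weak_grad \<Omega> u G"
  shows "u \<in> H1 \<Omega>" "H1_embed \<Omega> u = (L2_of \<Omega> u, L2_of \<Omega> G)"
proof -
  have \<Omega>l: "\<Omega> \<in> sets lebesgue" using \<Omega> by auto
  show uH: "u \<in> H1 \<Omega>" using u G by (auto simp: H1_def)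
  have "L2_of \<Omega> G = L2_of \<Omega> (wgrad \<Omega> u)"
    using wgrad_AE_eq(2)[OF \<Omega> G(2)] by (simp add: L2_of_eq_iff[OF \<Omega>l G(1) H1_wgrad(3)[OF \<Omega> uH]])
  then show "H1_embed \<Omega> u = (L2_of \<Omega> u, L2_of \<Omega> G)" by (simp add: H1_embed_def)
qed

lemma norm_H1_embed:
  assumes \<Omega>: "open \<Omega>" and u: "u \<in> H1 \<Omega>"
  shows "norm (H1_embed \<Omega> u) = H1_norm \<Omega> u"
proof -
  have "\<Omega> \<in> sets lebesgue" using \<Omega> by auto
  then show ?thesis
    unfolding H1_embed_def norm_Pair H1_norm_def
    by (simp only: norm_L2_of H1_wgrad(1)[OF \<Omega> u] H1_wgrad(3)[OF \<Omega> u])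
qed

lemma H1_embed_lincomb:
  assumes \<Omega>: "open \<Omega>" and u: "u \<in> H1 \<Omega>" and v: "v \<in> H1 \<Omega>"
  shows "(\<lambda>x. a * u x + b * v x) \<in> H1 \<Omega>"
    and "H1_embed \<Omega> (\<lambda>x. a * u x + b * v x) = a *\<^sub>R H1_embed \<Omega> u + b *\<^sub>R H1_embed \<Omega> v"
proof -
  have \<Omega>l: "\<Omega> \<in> sets lebesgue" using \<Omega> by auto
  note U = H1_wgrad[OF \<Omega> u] and V = H1_wgrad[OF \<Omega> v]
  have L: "(\<lambda>x. a *\<^sub>R u x + b *\<^sub>R v x) \<in> L2_space \<Omega>"
    "(\<lambda>x. a *\<^sub>R wgrad \<Omega> u x + b *\<^sub>R wgrad \<Omega> v x) \<in> L2_space \<Omega>"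
    by (rule L2_space_add[OF L2_space_scaleR[OF U(1)] L2_space_scaleR[OF V(1)]],
        rule L2_space_add[OF L2_space_scaleR[OF U(3)] L2_space_scaleR[OF V(3)]])
  note e = H1_embed_eqI[OF \<Omega> L(1)[unfolded real_scaleR_def] L(2) has_weak_grad_lincomb[OF \<Omega>l U(2) V(2)]]
  show "(\<lambda>x. a * u x + b * v x) \<in> H1 \<Omega>" by (rule e(1))
  have "L2_of \<Omega> (\<lambda>x. a *\<^sub>R u x + b *\<^sub>R v x) = a *\<^sub>R L2_of \<Omega> u + b *\<^sub>R L2_of \<Omega> v"
    "L2_of \<Omega> (\<lambda>x. a *\<^sub>R wgrad \<Omega> u x + b *\<^sub>R wgrad \<Omega> v x) = a *\<^sub>R L2_of \<Omega> (wgrad \<Omega> u) + b *\<^sub>R L2_of \<Omega> (wgrad \<Omega> v)"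
    using U V by (simp_all add: L2_of_add[OF \<Omega>l] L2_of_scaleR[OF \<Omega>l] L2_space_scaleR del: real_scaleR_def)
  then show "H1_embed \<Omega> (\<lambda>x. a * u x + b * v x) = a *\<^sub>R H1_embed \<Omega> u + b *\<^sub>R H1_embed \<Omega> v"
    unfolding e(2) by (simp add: H1_embed_def)
qed

lemma test_functions_H1:
  assumes \<Omega>: "open \<Omega>" and \<phi>: "\<phi> \<in> test_functions \<Omega>"
  shows "\<phi> \<in> H1 \<Omega>"
proof -
  have \<Omega>l: "\<Omega> \<in> sets lebesgue" using \<Omega> by auto
  show ?thesis
    by (rule H1_embed_eqI(1)[OF \<Omega> test_functions_L2[OF \<Omega>l \<phi>] grad_test_function_L2[OF \<Omega>l \<phi>]
          has_weak_grad_test_function[OF \<Omega>l \<phi>]])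
qed

lemma H10_iff_closure:
  assumes \<Omega>: "open \<Omega>" and u: "u \<in> H1 \<Omega>"
  shows "u \<in> H10 \<Omega> \<longleftrightarrow> H1_embed \<Omega> u \<in> closure (H1_embed \<Omega> ` test_functions \<Omega>)"
proof -
  have "H1_norm \<Omega> (\<lambda>x. u x - \<phi> x) = dist (H1_embed \<Omega> \<phi>) (H1_embed \<Omega> u)" if "\<phi> \<in> test_functions \<Omega>" for \<phi>
  proof -
    note e = H1_embed_lincomb[OF \<Omega> u test_functions_H1[OF \<Omega> that], of 1 "-1"]
    show ?thesis
      using norm_H1_embed[OF \<Omega> e(1)] e(2) by (simp add: dist_norm norm_minus_commute)
  qed
  then show ?thesis using u by (simp add: H10_def closure_approachable)
qed

lemma bounded_fibre_map_id: "\<Omega> \<in> sets lebesgue \<Longrightarrow> bounded_fibre_map \<Omega> (\<lambda>x y. y) 1"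
  by (simp add: bounded_fibre_map_def linear_id[unfolded id_def])

text \<open>The substantial inclusion says that a limit of pairs from test functions is again a pair
  of a function on \<Omega> and its weak gradient. Both requirements are closed conditions, so they
  pass to the closure.\<close>

lemma H1_embed_H10:
  assumes \<Omega>: "open \<Omega>"
  shows "H1_embed \<Omega> ` H10 \<Omega> = closure (H1_embed \<Omega> ` test_functions \<Omega>)"
proof
  show "H1_embed \<Omega> ` H10 \<Omega> \<subseteq> closure (H1_embed \<Omega> ` test_functions \<Omega>)"
    using H10_iff_closure[OF \<Omega>] by (auto simp: H10_def)
  have \<Omega>l: "\<Omega> \<in> sets lebesgue" using \<Omega> by auto
  note id = bounded_fibre_map_id[OF \<Omega>l]
  let ?R = "\<lambda>F. L2_map \<Omega> (\<lambda>x y. y) F"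
  have cont: "continuous_on UNIV (L2_map \<Omega> (\<lambda>x y. y) :: ('a, 'c::euclidean_space) L2 \<Rightarrow> _)"
    using linear_continuous_on[OF L2_map_bounded_linear[OF id]] by auto
  \<comment> \<open>The equations with \<open>?R\<close> say that both classes vanish off \<Omega>;
    the rest is \<open>has_weak_grad_iff_inner\<close>.\<close>
  define S where "S = {p :: ('a, real) L2 \<times> ('a, 'a) L2. ?R (fst p) = fst p \<and> ?R (snd p) = snd p \<and>
    (\<forall>\<phi>\<in>test_functions \<Omega>. \<forall>i\<in>Basis. fst p \<bullet> L2_of \<Omega> (\<lambda>x. frechet_derivative \<phi> (at x) i)
        = - (snd p \<bullet> L2_of \<Omega> (\<lambda>x. \<phi> x *\<^sub>R i)))}"
  have "closed S"
    unfolding S_def Ball_def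
    by (intro closed_Collect_conj closed_Collect_all closed_Collect_imp closed_Collect_eq open_Collect_const
        continuous_intros continuous_on_compose2[OF cont]) auto
  moreover have "H1_embed \<Omega> \<phi> \<in> S" if "\<phi> \<in> test_functions \<Omega>" for \<phi>
  proof -
    note \<phi> = H1_wgrad[OF \<Omega> test_functions_H1[OF \<Omega> that]]
    show ?thesis
      using \<phi> has_weak_grad_iff_inner[OF \<Omega>l \<phi>(1,3)]
      by (simp add: S_def H1_embed_def L2_map_of[OF id])
  qed
  ultimately have sub: "closure (H1_embed \<Omega> ` test_functions \<Omega>) \<subseteq> S"
    by (intro closure_minimal) auto
  show "closure (H1_embed \<Omega> ` test_functions \<Omega>) \<subseteq> H1_embed \<Omega> ` H10 \<Omega>"
  proof
    fix p assume p: "p \<in> closure (H1_embed \<Omega> ` test_functions \<Omega>)"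
    then have pS: "p \<in> S" using sub by blast
    define u where "u = rep_L2 (fst p)"
    define G where "G = rep_L2 (snd p)"
    have L: "u \<in> L2_space \<Omega>" "G \<in> L2_space \<Omega>"
      by (auto simp: u_def G_def intro: L2_space_restrict[OF \<Omega>l] rep_L2_space)
    have eq: "L2_of \<Omega> u = fst p" "L2_of \<Omega> G = snd p"
      using pS by (simp_all add: S_def L2_map_def u_def G_def)
    have "has_weak_grad \<Omega> u G"
      using pS by (simp add: has_weak_grad_iff_inner[OF \<Omega>l L] eq S_def)
    note e = H1_embed_eqI[OF \<Omega> L this]
    then have pe: "p = H1_embed \<Omega> u" by (simp add: eq)
    then have "u \<in> H10 \<Omega>" using H10_iff_closure[OF \<Omega> e(1)] p by simp
    then show "p \<in> H1_embed \<Omega> ` H10 \<Omega>" using pe by blast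
  qed
qed

text \<open>Linear combinations of test functions are test functions, and sequences carry this over
  to the closure, which is the image of \<open>H10\<close>.\<close>

lemma subspace_H1_embed_H10:
  assumes \<Omega>: "open \<Omega>"
  shows "subspace (H1_embed \<Omega> ` H10 \<Omega>)" "closed (H1_embed \<Omega> ` H10 \<Omega>)"
proof -
  let ?T = "H1_embed \<Omega> ` test_functions \<Omega>"
  have T: "a *\<^sub>R p + b *\<^sub>R q \<in> ?T" if pq: "p \<in> ?T" "q \<in> ?T" for a b p q
  proof -
    obtain \<phi> \<eta> where t: "\<phi> \<in> test_functions \<Omega>" "\<eta> \<in> test_functions \<Omega>" "p = H1_embed \<Omega> \<phi>" "q = H1_embed \<Omega> \<eta>"
      using pq by blast
    then show ?thesis
      using H1_embed_lincomb(2)[OF \<Omega> test_functions_H1[OF \<Omega> t(1)] test_functions_H1[OF \<Omega> t(2)], of a b]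
        test_functions_lincomb[OF t(1,2), of a b] by force
  qed
  have cl: "a *\<^sub>R p + b *\<^sub>R q \<in> closure ?T" if pq: "p \<in> closure ?T" "q \<in> closure ?T" for a b p q
  proof -
    obtain x y where "\<And>n. x n \<in> ?T" "x \<longlonglongrightarrow> p" "\<And>n. y n \<in> ?T" "y \<longlonglongrightarrow> q"
      using pq unfolding closure_sequential by metis
    then show ?thesis
      unfolding closure_sequential
      by (intro exI[of _ "\<lambda>n. a *\<^sub>R x n + b *\<^sub>R y n"] conjI allI T tendsto_intros)
  qed
  have z: "H1_embed \<Omega> (\<lambda>x. 0) \<in> closure ?T"
    using test_functions_zero closure_subset by blast
  show "subspace (H1_embed \<Omega> ` H10 \<Omega>)"
    unfolding H1_embed_H10[OF \<Omega>]
  proof (rule subspaceI)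
    show "0 \<in> closure ?T" using cl[OF z z, of 0 0] by simp
    show "x + y \<in> closure ?T" if "x \<in> closure ?T" "y \<in> closure ?T" for x y
      using cl[OF that, of 1 1] by simp
    show "c *\<^sub>R x \<in> closure ?T" if "x \<in> closure ?T" for x c
      using cl[OF that that, of c 0] by simp
  qed
  show "closed (H1_embed \<Omega> ` H10 \<Omega>)" by (simp add: H1_embed_H10[OF \<Omega>])
qed

section \<open>The linearised Poisson--Nernst--Planck form\<close>

text \<open>
  A pair \<open>(u, g)\<close> stands for a function and its gradient; \<open>P\<close>, \<open>N\<close> and \<open>S\<close> stand for the
  multiplications by \<open>p\<close>, by \<open>n\<close> and by the gradient of \<open>\<psi>\<close>.
\<close>

fun linearised_form ::
  "('g \<Rightarrow> 'g) \<Rightarrow> ('g \<Rightarrow> 'g) \<Rightarrow> ('u \<Rightarrow> 'g) \<Rightarrow> real \<Rightarrow>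
    ('u::real_inner \<times> 'g::real_inner) \<times> ('u \<times> 'g) \<times> ('u \<times> 'g) \<Rightarrow>
    ('u \<times> 'g) \<times> ('u \<times> 'g) \<times> ('u \<times> 'g) \<Rightarrow> real" where
  "linearised_form P N S \<epsilon> ((u1, g1), (u2, g2), (u3, g3)) ((v1, h1), (v2, h2), (v3, h3)) =
     g1 \<bullet> h1 + P g3 \<bullet> h1 + S u1 \<bullet> h1 + g2 \<bullet> h2 - N g3 \<bullet> h2 - S u2 \<bullet> h2
       + \<epsilon> * (g3 \<bullet> h3) - u1 \<bullet> v3 + u2 \<bullet> v3"

text \<open>The last assumption says that the symmetric 3 by 3 matrix of the form has positive
  determinant. Young's inequality with the same weight \<delta> in both mixed terms leaves
  \<open>\<beta> - \<delta>\<close> and \<open>\<gamma> - 2 * M^2 / \<delta>\<close>.\<close>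

lemma quadratic_form_coercive:
  fixes \<beta> \<gamma> M :: real
  assumes "0 < \<beta>" "0 < \<gamma>" "2 * M\<^sup>2 < \<beta> * \<gamma>"
  shows "\<exists>c>0. \<forall>a b d. c * (a\<^sup>2 + b\<^sup>2 + d\<^sup>2) \<le> \<beta> * (a\<^sup>2 + b\<^sup>2) + \<gamma> * d\<^sup>2 - 2 * M * d * (a + b)"
proof -
  \<comment> \<open>The midpoint of the interval from \<open>2 * M^2 / \<gamma>\<close> to \<beta>;
    any weight strictly inside keeps both remainders positive.\<close>
  define \<delta> where "\<delta> = (\<beta> + 2 * M\<^sup>2 / \<gamma>) / 2"
  have lt: "2 * M\<^sup>2 / \<gamma> < \<beta>" using assms by (simp add: field_simps)
  have ge: "0 \<le> 2 * M\<^sup>2 / \<gamma>" using assms(2) by simp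
  have \<delta>: "2 * M\<^sup>2 / \<gamma> < \<delta>" "\<delta> < \<beta>" "0 < \<delta>"
    using lt ge assms(1) by (auto simp: \<delta>_def)
  have \<gamma>: "2 * M\<^sup>2 / \<delta> < \<gamma>"
    using \<delta>(1,3) assms(2) by (simp add: field_simps)
  define m where "m = M\<^sup>2 / \<delta>"
  define c where "c = min (\<beta> - \<delta>) (\<gamma> - 2 * m)"
  have c: "c > 0" "c \<le> \<beta> - \<delta>" "c \<le> \<gamma> - 2 * m" using \<delta> \<gamma> by (auto simp: c_def m_def)
  have amgm: "2 * M * d * a \<le> \<delta> * a\<^sup>2 + m * d\<^sup>2" for a d
  proof -
    have "0 \<le> (\<delta> * a - M * d)\<^sup>2 / \<delta>" using \<delta>(3) by simp
    also have "\<dots> = \<delta> * a\<^sup>2 + m * d\<^sup>2 - 2 * M * d * a"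
      using \<delta>(3) by (simp add: m_def power2_eq_square field_simps)
    finally show ?thesis by simp
  qed
  have "c * (a\<^sup>2 + b\<^sup>2 + d\<^sup>2) \<le> \<beta> * (a\<^sup>2 + b\<^sup>2) + \<gamma> * d\<^sup>2 - 2 * M * d * (a + b)" for a b d
  proof -
    have "c * (a\<^sup>2 + b\<^sup>2) \<le> (\<beta> - \<delta>) * (a\<^sup>2 + b\<^sup>2)" "c * d\<^sup>2 \<le> (\<gamma> - 2 * m) * d\<^sup>2"
      using c by (intro mult_right_mono; simp)+
    then show ?thesis
      using amgm[of d a] amgm[of d b] by (simp add: algebra_simps)
  qed
  with c(1) show ?thesis by blast
qed

text \<open>
  Testing the third equation with \<open>\<mu> = M / C\<^sup>2\<close> times the third component balances the two
  kinds of off-diagonal terms and makes the form coercive.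
\<close>

lemma linearised_form_unique_solution:
  fixes H :: "('u::{real_inner,complete_space} \<times> 'g::{real_inner,complete_space}) set"
    and r1 r2 r3 :: 'u
  assumes H: "subspace H" "closed H"
    and bl: "bounded_linear P" "bounded_linear N" "bounded_linear S"
    and bd: "\<And>g. norm (P g) \<le> M * norm g" "\<And>g. norm (N g) \<le> M * norm g" "\<And>u. norm (S u) \<le> K * norm u"
    and pos: "0 < M" "0 \<le> K" "0 < C" "0 < \<epsilon>"
    and poincare: "\<And>u g. (u, g) \<in> H \<Longrightarrow> norm u \<le> C * norm g"
    and small: "K * C + 2 * M * C\<^sup>2 / \<epsilon> < 1"
  shows "\<exists>!X. X \<in> H \<times> H \<times> H \<and> (\<forall>v1 h1 v2 h2 v3 h3. (v1, h1) \<in> H \<and> (v2, h2) \<in> H \<and> (v3, h3) \<in> H \<longrightarrow>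
    linearised_form P N S \<epsilon> X ((v1, h1), (v2, h2), (v3, h3)) = r1 \<bullet> v1 + r2 \<bullet> v2 + r3 \<bullet> v3)"
proof -
  define \<mu> where "\<mu> = M / C\<^sup>2"
  have \<mu>: "\<mu> > 0" "\<mu> * C\<^sup>2 = M" using pos by (simp_all add: \<mu>_def)
  \<comment> \<open>T represents the form whose third test pair is multiplied by \<mu>. The zeros
    occur because the first two equations involve their test functions only through
    gradients.\<close>
  define T :: "('u \<times> 'g) \<times> ('u \<times> 'g) \<times> ('u \<times> 'g) \<Rightarrow> ('u \<times> 'g) \<times> ('u \<times> 'g) \<times> ('u \<times> 'g)" where
    "T X = ((0, snd (fst X) + P (snd (snd (snd X))) + S (fst (fst X))),
            (0, snd (fst (snd X)) - N (snd (snd (snd X))) - S (fst (fst (snd X)))),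
            (\<mu> *\<^sub>R (fst (fst (snd X)) - fst (fst X)), (\<mu> * \<epsilon>) *\<^sub>R snd (snd (snd X))))" for X
  have T_bl: "bounded_linear T"
    unfolding T_def
    by (intro bounded_linear_Pair bounded_linear_add bounded_linear_sub bounded_linear_zero
        bounded_linear_compose[OF bl(1)] bounded_linear_compose[OF bl(2)] bounded_linear_compose[OF bl(3)]
        bounded_linear_compose[OF bounded_linear_fst] bounded_linear_compose[OF bounded_linear_snd]
        bounded_linear_compose[OF bounded_linear_scaleR_right] bounded_linear_ident)
  define r :: "('u \<times> 'g) \<times> ('u \<times> 'g) \<times> ('u \<times> 'g)" where "r = ((r1, 0), (r2, 0), (\<mu> *\<^sub>R r3, 0))"
  have T_form: "T X \<bullet> ((v1, h1), (v2, h2), (v3, h3))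
      = linearised_form P N S \<epsilon> X ((v1, h1), (v2, h2), (\<mu> *\<^sub>R v3, \<mu> *\<^sub>R h3))"
    for X v1 h1 v2 h2 v3 h3
  proof -
    obtain u1 g1 u2 g2 u3 g3 where "X = ((u1, g1), (u2, g2), (u3, g3))" by (metis surj_pair)
    then show ?thesis by (simp add: T_def inner_add_left inner_diff_left algebra_simps)
  qed
  have r_form: "r \<bullet> ((v1, h1), (v2, h2), (v3, h3)) = r1 \<bullet> v1 + r2 \<bullet> v2 + r3 \<bullet> (\<mu> *\<^sub>R v3)" for v1 h1 v2 h2 v3 h3
    by (simp add: r_def)
  define \<beta> where "\<beta> = 1 - K * C"
  have lt: "2 * M * C\<^sup>2 / \<epsilon> < \<beta>" using small by (simp add: \<beta>_def)
  have "0 \<le> 2 * M * C\<^sup>2 / \<epsilon>" using pos by simp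
  with lt have "0 < \<beta>" by linarith
  moreover have "2 * M * C\<^sup>2 < \<beta> * \<epsilon>" using lt pos(4) by (simp add: field_simps)
  ultimately have \<beta>: "0 < \<beta>" "2 * M * C\<^sup>2 < \<beta> * \<epsilon>" by simp_all
  have "2 * M\<^sup>2 < \<beta> * (\<mu> * \<epsilon>)"
  proof -
    have "2 * M\<^sup>2 = \<mu> * (2 * M * C\<^sup>2)" using \<mu>(2) by (simp add: power2_eq_square mult_ac)
    also have "\<dots> < \<mu> * (\<beta> * \<epsilon>)" using \<beta>(2) \<mu>(1) by simp
    finally show ?thesis by (simp add: mult_ac)
  qed
  then obtain c where c: "c > 0" "\<And>a b d. c * (a\<^sup>2 + b\<^sup>2 + d\<^sup>2)
      \<le> \<beta> * (a\<^sup>2 + b\<^sup>2) + (\<mu> * \<epsilon>) * d\<^sup>2 - 2 * M * d * (a + b)"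
    using quadratic_form_coercive[of \<beta> "\<mu> * \<epsilon>" M] \<beta>(1) \<mu>(1) pos(4) by auto
  \<comment> \<open>The estimates give coercivity only in the three gradients. On H the Poincare
    inequality bounds the full squared norm by \<open>1 + C^2\<close> times the squared gradients,
    hence the division.\<close>
  have coercive: "c / (1 + C\<^sup>2) * (norm X)\<^sup>2 \<le> T X \<bullet> X" if X: "X \<in> H \<times> H \<times> H" for X
  proof -
    obtain u1 g1 u2 g2 u3 g3 where X_eq: "X = ((u1, g1), (u2, g2), (u3, g3))"
      by (metis surj_pair)
    have u: "norm u1 \<le> C * norm g1" "norm u2 \<le> C * norm g2" "norm u3 \<le> C * norm g3"
      using X poincare by (auto simp: X_eq)
    have CS: "- (A * norm y * norm z) \<le> x \<bullet> z" "x \<bullet> z \<le> A * norm y * norm z"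
      if "norm x \<le> A * norm y" for x z :: "'w::real_inner" and y :: "'y::real_normed_vector" and A
    proof -
      have "\<bar>x \<bullet> z\<bar> \<le> norm x * norm z" by (rule Cauchy_Schwarz_ineq2)
      also have "\<dots> \<le> (A * norm y) * norm z" using that by (intro mult_right_mono) auto
      finally show "- (A * norm y * norm z) \<le> x \<bullet> z" "x \<bullet> z \<le> A * norm y * norm z" by auto
    qed
    have S: "norm (S u1) \<le> (K * C) * norm g1" "norm (S u2) \<le> (K * C) * norm g2"
      using bd(3)[of u1] bd(3)[of u2] mult_left_mono[OF u(1) pos(2)] mult_left_mono[OF u(2) pos(2)]
      by (simp_all add: mult.assoc)
    have UU: "\<bar>a \<bullet> u3\<bar> \<le> C\<^sup>2 * (norm g * norm g3)" if "norm a \<le> C * norm g" for a :: 'u and g :: 'g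
    proof -
      have "\<bar>a \<bullet> u3\<bar> \<le> norm a * norm u3" by (rule Cauchy_Schwarz_ineq2)
      also have "\<dots> \<le> (C * norm g) * (C * norm g3)" using that u(3) pos(3) by (intro mult_mono) auto
      finally show ?thesis by (simp add: power2_eq_square mult_ac)
    qed
    \<comment> \<open>By \<open>\<mu> * C^2 = M\<close> these terms obtain the same coefficient M as
      those with P and N; together they give the factor 2 M in the quadratic form.\<close>
    have "\<mu> * \<bar>u1 \<bullet> u3\<bar> \<le> M * (norm g1 * norm g3)" "\<mu> * \<bar>u2 \<bullet> u3\<bar> \<le> M * (norm g2 * norm g3)"
      using mult_left_mono[OF UU[OF u(1)], of \<mu>] mult_left_mono[OF UU[OF u(2)], of \<mu>] \<mu>
      by (simp_all add: mult.assoc[symmetric])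
    moreover have "\<mu> * (u1 \<bullet> u3) \<le> \<mu> * \<bar>u1 \<bullet> u3\<bar>" "- (\<mu> * \<bar>u2 \<bullet> u3\<bar>) \<le> \<mu> * (u2 \<bullet> u3)"
      using mult_left_mono[of "u1 \<bullet> u3" "\<bar>u1 \<bullet> u3\<bar>" \<mu>] mult_left_mono[of "- \<bar>u2 \<bullet> u3\<bar>" "u2 \<bullet> u3" \<mu>] \<mu>(1)
      by simp_all
    moreover have "- (M * norm g3 * norm g1) \<le> P g3 \<bullet> g1" "N g3 \<bullet> g2 \<le> M * norm g3 * norm g2"
      "- (K * C * norm g1 * norm g1) \<le> S u1 \<bullet> g1" "S u2 \<bullet> g2 \<le> K * C * norm g2 * norm g2"
      by (fact CS(1)[OF bd(1)] CS(2)[OF bd(2)] CS(1)[OF S(1)] CS(2)[OF S(2)])+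
    moreover have "T X \<bullet> X = (norm g1)\<^sup>2 + P g3 \<bullet> g1 + S u1 \<bullet> g1 + (norm g2)\<^sup>2 - N g3 \<bullet> g2 - S u2 \<bullet> g2
        + (\<mu> * \<epsilon>) * (norm g3)\<^sup>2 - \<mu> * (u1 \<bullet> u3) + \<mu> * (u2 \<bullet> u3)"
      by (simp add: X_eq T_def inner_add_left inner_diff_left power2_norm_eq_inner algebra_simps)
    ultimately have "\<beta> * ((norm g1)\<^sup>2 + (norm g2)\<^sup>2) + (\<mu> * \<epsilon>) * (norm g3)\<^sup>2
        - 2 * M * norm g3 * (norm g1 + norm g2) \<le> T X \<bullet> X"
      by (simp add: \<beta>_def power2_eq_square algebra_simps)
    with c(2)[of "norm g1" "norm g2" "norm g3"]
    have le: "c * ((norm g1)\<^sup>2 + (norm g2)\<^sup>2 + (norm g3)\<^sup>2) \<le> T X \<bullet> X" by linarith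
    have sq: "(norm u1)\<^sup>2 \<le> C\<^sup>2 * (norm g1)\<^sup>2" "(norm u2)\<^sup>2 \<le> C\<^sup>2 * (norm g2)\<^sup>2" "(norm u3)\<^sup>2 \<le> C\<^sup>2 * (norm g3)\<^sup>2"
      using u by (auto simp flip: power_mult_distrib intro!: power_mono)
    have "(norm X)\<^sup>2 = (norm u1)\<^sup>2 + (norm g1)\<^sup>2 + ((norm u2)\<^sup>2 + (norm g2)\<^sup>2 + ((norm u3)\<^sup>2 + (norm g3)\<^sup>2))"
      by (simp add: X_eq norm_Pair)
    also have "\<dots> \<le> (1 + C\<^sup>2) * ((norm g1)\<^sup>2 + (norm g2)\<^sup>2 + (norm g3)\<^sup>2)"
      using sq by (simp add: algebra_simps)
    finally have "c / (1 + C\<^sup>2) * (norm X)\<^sup>2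
        \<le> c / (1 + C\<^sup>2) * ((1 + C\<^sup>2) * ((norm g1)\<^sup>2 + (norm g2)\<^sup>2 + (norm g3)\<^sup>2))"
      using c(1) by (intro mult_left_mono) auto
    moreover have "1 + C\<^sup>2 > 0" by (simp add: add_pos_nonneg)
    ultimately show ?thesis using le by simp
  qed
  have W: "subspace (H \<times> H \<times> H)" "closed (H \<times> H \<times> H)"
    using H by (simp_all add: subspace_Times closed_Times)
  have cpos: "c / (1 + C\<^sup>2) > 0" using c(1) by (simp add: add_pos_nonneg)
  have sc: "(a *\<^sub>R v, a *\<^sub>R h) \<in> H" if "(v, h) \<in> H" for a v h
    using subspace_mul[OF H(1) that] by simp
  have eqv: "(\<forall>V\<in>H \<times> H \<times> H. T X \<bullet> V = r \<bullet> V) \<longleftrightarrow>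
      (\<forall>v1 h1 v2 h2 v3 h3. (v1, h1) \<in> H \<and> (v2, h2) \<in> H \<and> (v3, h3) \<in> H \<longrightarrow>
    linearised_form P N S \<epsilon> X ((v1, h1), (v2, h2), (v3, h3)) = r1 \<bullet> v1 + r2 \<bullet> v2 + r3 \<bullet> v3)" (is "?A \<longleftrightarrow> ?B") for X
  proof
    assume A: ?A
    show ?B
    proof (intro allI impI, elim conjE)
      fix v1 h1 v2 h2 v3 h3
      assume V: "(v1, h1) \<in> H" "(v2, h2) \<in> H" "(v3, h3) \<in> H"
      \<comment> \<open>The third test pair is divided by \<mu> in advance, which the scaling built
        into T and r then undoes.\<close>
      then have "((v1, h1), (v2, h2), (inverse \<mu> *\<^sub>R v3, inverse \<mu> *\<^sub>R h3)) \<in> H \<times> H \<times> H" using sc by simp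
      from bspec[OF A this]
      show "linearised_form P N S \<epsilon> X ((v1, h1), (v2, h2), (v3, h3)) = r1 \<bullet> v1 + r2 \<bullet> v2 + r3 \<bullet> v3"
        unfolding T_form r_form using \<mu>(1) by simp
    qed
  next
    assume B: ?B
    show ?A
    proof
      fix V assume V: "V \<in> H \<times> H \<times> H"
      then obtain v1 h1 v2 h2 v3 h3 where V_eq: "V = ((v1, h1), (v2, h2), (v3, h3))"
        and "(v1, h1) \<in> H" "(v2, h2) \<in> H" "(v3, h3) \<in> H" by auto
      then have "linearised_form P N S \<epsilon> X ((v1, h1), (v2, h2), (\<mu> *\<^sub>R v3, \<mu> *\<^sub>R h3))
          = r1 \<bullet> v1 + r2 \<bullet> v2 + r3 \<bullet> (\<mu> *\<^sub>R v3)"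
        using B sc by blast
      then show "T X \<bullet> V = r \<bullet> V" unfolding V_eq T_form r_form .
    qed
  qed
  show ?thesis
    using lax_milgram[OF W T_bl cpos coercive, of r] unfolding eqv .
qed

section \<open>Bounded coefficients and the form on H1\<close>

lemma Linf_spaceD:
  assumes "f \<in> Linf_space \<Omega>"
  shows "f \<in> borel_measurable (lebesgue_on \<Omega>)" "AE x in lebesgue_on \<Omega>. norm (f x) \<le> Linf_norm \<Omega> f"
proof -
  show "f \<in> borel_measurable (lebesgue_on \<Omega>)" using assms by (simp add: Linf_space_def)
  let ?s = "esssup (lebesgue_on \<Omega>) (\<lambda>x. ereal (norm (f x)))"
  have fin: "?s < \<infinity>" using assms by (simp add: Linf_space_def)
  have "AE x in lebesgue_on \<Omega>. ereal (norm (f x)) \<le> ?s" by (rule esssup_AE)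
  then show "AE x in lebesgue_on \<Omega>. norm (f x) \<le> Linf_norm \<Omega> f"
  proof eventually_elim
    case (elim x)
    with fin show ?case by (cases ?s) (auto simp: Linf_norm_def)
  qed
qed

text \<open>A negative essential bound would be violated by a norm at every point, so \<Omega> would
  be null, which a nonempty open set is not.\<close>

lemma Linf_norm_nonneg:
  assumes \<Omega>: "open \<Omega>" "\<Omega> \<noteq> {}" and f: "f \<in> Linf_space \<Omega>"
  shows "0 \<le> Linf_norm \<Omega> f"
proof (rule ccontr)
  assume neg: "\<not> 0 \<le> Linf_norm \<Omega> f"
  have \<Omega>l: "\<Omega> \<in> sets lebesgue" using \<Omega>(1) by auto
  have "AE x in lebesgue_on \<Omega>. False"
    using Linf_spaceD(2)[OF f]
  proof eventually_elim
    case (elim x)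
    then show ?case using neg norm_ge_zero[of "f x"] by linarith
  qed
  then have "AE x in lebesgue. x \<notin> \<Omega>" using \<Omega>l by (simp add: AE_restrict_space_iff)
  then have "negligible \<Omega>" using \<Omega>l by (simp add: negligible_iff_null_sets AE_iff_null_sets)
  then show False using \<Omega> open_not_negligible by blast
qed

lemma W1inf_wgrad:
  assumes \<Omega>: "open \<Omega>" and \<psi>: "\<psi> \<in> W1inf \<Omega>"
  shows "wgrad \<Omega> \<psi> \<in> Linf_space \<Omega>"
proof -
  have \<Omega>l: "\<Omega> \<in> sets lebesgue" using \<Omega> by auto
  obtain G where G: "G \<in> Linf_space \<Omega>" "has_weak_grad \<Omega> \<psi> G" using \<psi> by (auto simp: W1inf_def)
  note eq = wgrad_AE_eq(2)[OF \<Omega> G(2)]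
  have Gm: "G \<in> borel_measurable (lebesgue_on \<Omega>)" by (rule Linf_spaceD(1)[OF G(1)])
  have wm: "wgrad \<Omega> \<psi> \<in> borel_measurable (lebesgue_on \<Omega>)"
    by (rule borel_measurable_AE_lebesgue_on[OF \<Omega>l Gm eq])
  have "esssup (lebesgue_on \<Omega>) (\<lambda>x. ereal (norm (G x))) = esssup (lebesgue_on \<Omega>) (\<lambda>x. ereal (norm (wgrad \<Omega> \<psi> x)))"
  proof (rule esssup_AE_cong)
    show "(\<lambda>x. ereal (norm (G x))) \<in> borel_measurable (lebesgue_on \<Omega>)" using Gm by measurable
    show "(\<lambda>x. ereal (norm (wgrad \<Omega> \<psi> x))) \<in> borel_measurable (lebesgue_on \<Omega>)" using wm by measurable
    show "AE x in lebesgue_on \<Omega>. ereal (norm (G x)) = ereal (norm (wgrad \<Omega> \<psi> x))"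
      using eq by eventually_elim simp
  qed
  with G(1) wm show ?thesis by (simp add: Linf_space_def)
qed

lemma bounded_fibre_map_scaleR:
  assumes "\<Omega> \<in> sets lebesgue" "p \<in> Linf_space \<Omega>" "Linf_norm \<Omega> p \<le> M"
  shows "bounded_fibre_map \<Omega> (\<lambda>x y. p x *\<^sub>R (y::'b::euclidean_space)) M"
  unfolding bounded_fibre_map_def
proof (intro conjI allI ballI)
  show "linear (\<lambda>y::'b. p x *\<^sub>R y)" for x by (rule linear_scaleR)
  show "(\<lambda>x. p x *\<^sub>R f x) \<in> borel_measurable (lebesgue_on \<Omega>)"
    if "f \<in> borel_measurable (lebesgue_on \<Omega>)" for f :: "_ \<Rightarrow> 'b"
    using Linf_spaceD(1)[OF assms(2)] that by (rule borel_measurable_scaleR)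
  show "AE x in lebesgue_on \<Omega>. \<forall>y::'b. norm (p x *\<^sub>R y) \<le> M * norm y"
    using Linf_spaceD(2)[OF assms(2)]
  proof eventually_elim
    case (elim x)
    then have "\<bar>p x\<bar> \<le> M" using assms(3) by simp
    then show ?case by (auto intro: mult_right_mono)
  qed
qed (rule assms(1))

lemma bounded_fibre_map_scaleR_left:
  assumes "\<Omega> \<in> sets lebesgue" "G \<in> Linf_space \<Omega>" "Linf_norm \<Omega> G \<le> K"
  shows "bounded_fibre_map \<Omega> (\<lambda>x c. c *\<^sub>R G x) K"
  unfolding bounded_fibre_map_def
proof (intro conjI allI ballI)
  show "linear (\<lambda>c. c *\<^sub>R G x)" for x
    by (rule linearI) (simp_all add: scaleR_add_left)
  show "(\<lambda>x. f x *\<^sub>R G x) \<in> borel_measurable (lebesgue_on \<Omega>)"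
    if "f \<in> borel_measurable (lebesgue_on \<Omega>)" for f :: "_ \<Rightarrow> real"
    using that Linf_spaceD(1)[OF assms(2)] by (rule borel_measurable_scaleR)
  show "AE x in lebesgue_on \<Omega>. \<forall>c. norm (c *\<^sub>R G x) \<le> K * norm c"
    using Linf_spaceD(2)[OF assms(2)]
  proof eventually_elim
    case (elim x)
    then have "norm (G x) \<le> K" using assms(3) by simp
    then show ?case by (auto simp: mult.commute[of K] intro: mult_left_mono)
  qed
qed (rule assms(1))

text \<open>The integral may be split only after each of the nine terms is known to be integrable.
  Each is a product of two L2 functions once the bounded coefficient is absorbed into the first
  factor.\<close>

lemma PNP_DF_eq_form:
  assumes \<Omega>: "open \<Omega>" and p: "p \<in> Linf_space \<Omega>" and n: "n \<in> Linf_space \<Omega>" and \<psi>: "wgrad \<Omega> \<psi> \<in> Linf_space \<Omega>"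
    and \<phi>: "\<phi>1 \<in> H1 \<Omega>" "\<phi>2 \<in> H1 \<Omega>" "\<phi>3 \<in> H1 \<Omega>" and v: "v1 \<in> H1 \<Omega>" "v2 \<in> H1 \<Omega>" "v3 \<in> H1 \<Omega>"
  shows "PNP_DF \<Omega> \<epsilon> (p, n, \<psi>) (\<phi>1, \<phi>2, \<phi>3) (v1, v2, v3) =
    linearised_form (L2_map \<Omega> (\<lambda>x y. p x *\<^sub>R y)) (L2_map \<Omega> (\<lambda>x y. n x *\<^sub>R y))
      (L2_map \<Omega> (\<lambda>x c. c *\<^sub>R wgrad \<Omega> \<psi> x)) \<epsilon>
      (H1_embed \<Omega> \<phi>1, H1_embed \<Omega> \<phi>2, H1_embed \<Omega> \<phi>3) (H1_embed \<Omega> v1, H1_embed \<Omega> v2, H1_embed \<Omega> v3)"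
proof -
  have \<Omega>l: "\<Omega> \<in> sets lebesgue" using \<Omega> by auto
  note P = bounded_fibre_map_scaleR[OF \<Omega>l p order_refl, where 'b = 'a]
  note N = bounded_fibre_map_scaleR[OF \<Omega>l n order_refl, where 'b = 'a]
  note S = bounded_fibre_map_scaleR_left[OF \<Omega>l \<psi> order_refl]
  note F = H1_wgrad(1,3)[OF \<Omega> \<phi>(1)] H1_wgrad(1,3)[OF \<Omega> \<phi>(2)] H1_wgrad(1,3)[OF \<Omega> \<phi>(3)]
  note V = H1_wgrad(1,3)[OF \<Omega> v(1)] H1_wgrad(1,3)[OF \<Omega> v(2)] H1_wgrad(1,3)[OF \<Omega> v(3)]
  note PF = bounded_fibre_map_L2[OF P F(6)] and NF = bounded_fibre_map_L2[OF N F(6)]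
    and SF = bounded_fibre_map_L2[OF S F(1)] bounded_fibre_map_L2[OF S F(3)]
  have int: "integrable (lebesgue_on \<Omega>) (\<lambda>x. wgrad \<Omega> \<phi>1 x \<bullet> wgrad \<Omega> v1 x)"
    "integrable (lebesgue_on \<Omega>) (\<lambda>x. p x * (wgrad \<Omega> \<phi>3 x \<bullet> wgrad \<Omega> v1 x))"
    "integrable (lebesgue_on \<Omega>) (\<lambda>x. \<phi>1 x * (wgrad \<Omega> \<psi> x \<bullet> wgrad \<Omega> v1 x))"
    "integrable (lebesgue_on \<Omega>) (\<lambda>x. wgrad \<Omega> \<phi>2 x \<bullet> wgrad \<Omega> v2 x)"
    "integrable (lebesgue_on \<Omega>) (\<lambda>x. n x * (wgrad \<Omega> \<phi>3 x \<bullet> wgrad \<Omega> v2 x))"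
    "integrable (lebesgue_on \<Omega>) (\<lambda>x. \<phi>2 x * (wgrad \<Omega> \<psi> x \<bullet> wgrad \<Omega> v2 x))"
    "integrable (lebesgue_on \<Omega>) (\<lambda>x. wgrad \<Omega> \<phi>3 x \<bullet> wgrad \<Omega> v3 x)"
    "integrable (lebesgue_on \<Omega>) (\<lambda>x. \<phi>1 x * v3 x)"
    "integrable (lebesgue_on \<Omega>) (\<lambda>x. \<phi>2 x * v3 x)"
    using L2_integrable_inner[OF F(2) V(2)] L2_integrable_inner[OF PF V(2)] L2_integrable_inner[OF SF(1) V(2)]
      L2_integrable_inner[OF F(4) V(4)] L2_integrable_inner[OF NF V(4)] L2_integrable_inner[OF SF(2) V(4)]
      L2_integrable_inner[OF F(6) V(6)] L2_integrable_inner[OF F(1) V(5)] L2_integrable_inner[OF F(3) V(5)]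
    by simp_all
  have form: "linearised_form (L2_map \<Omega> (\<lambda>x y. p x *\<^sub>R y)) (L2_map \<Omega> (\<lambda>x y. n x *\<^sub>R y))
      (L2_map \<Omega> (\<lambda>x c. c *\<^sub>R wgrad \<Omega> \<psi> x)) \<epsilon>
      (H1_embed \<Omega> \<phi>1, H1_embed \<Omega> \<phi>2, H1_embed \<Omega> \<phi>3) (H1_embed \<Omega> v1, H1_embed \<Omega> v2, H1_embed \<Omega> v3)
    = (LINT x|lebesgue_on \<Omega>. wgrad \<Omega> \<phi>1 x \<bullet> wgrad \<Omega> v1 x)
      + (LINT x|lebesgue_on \<Omega>. (p x *\<^sub>R wgrad \<Omega> \<phi>3 x) \<bullet> wgrad \<Omega> v1 x)
      + (LINT x|lebesgue_on \<Omega>. (\<phi>1 x *\<^sub>R wgrad \<Omega> \<psi> x) \<bullet> wgrad \<Omega> v1 x)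
      + (LINT x|lebesgue_on \<Omega>. wgrad \<Omega> \<phi>2 x \<bullet> wgrad \<Omega> v2 x)
      - (LINT x|lebesgue_on \<Omega>. (n x *\<^sub>R wgrad \<Omega> \<phi>3 x) \<bullet> wgrad \<Omega> v2 x)
      - (LINT x|lebesgue_on \<Omega>. (\<phi>2 x *\<^sub>R wgrad \<Omega> \<psi> x) \<bullet> wgrad \<Omega> v2 x)
      + \<epsilon> * (LINT x|lebesgue_on \<Omega>. wgrad \<Omega> \<phi>3 x \<bullet> wgrad \<Omega> v3 x)
      - (LINT x|lebesgue_on \<Omega>. \<phi>1 x \<bullet> v3 x) + (LINT x|lebesgue_on \<Omega>. \<phi>2 x \<bullet> v3 x)"
    unfolding H1_embed_def linearised_form.simps L2_map_of[OF P F(6)] L2_map_of[OF N F(6)]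
      L2_map_of[OF S F(1)] L2_map_of[OF S F(3)]
    by (simp only: inner_L2_of[OF \<Omega>l F(2) V(2)] inner_L2_of[OF \<Omega>l PF V(2)] inner_L2_of[OF \<Omega>l SF(1) V(2)]
      inner_L2_of[OF \<Omega>l F(4) V(4)] inner_L2_of[OF \<Omega>l NF V(4)] inner_L2_of[OF \<Omega>l SF(2) V(4)]
      inner_L2_of[OF \<Omega>l F(6) V(6)] inner_L2_of[OF \<Omega>l F(1) V(5)] inner_L2_of[OF \<Omega>l F(3) V(5)])
  show ?thesis unfolding form using int by simp
qed

lemma L2_pairing_eq:
  assumes \<Omega>: "\<Omega> \<in> sets lebesgue" and R: "(R1, R2, R3) \<in> cube (L2_space \<Omega>)" and v: "(v1, v2, v3) \<in> cube (L2_space \<Omega>)"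
  shows "L2_pairing \<Omega> (R1, R2, R3) (v1, v2, v3)
    = L2_of \<Omega> R1 \<bullet> L2_of \<Omega> v1 + L2_of \<Omega> R2 \<bullet> L2_of \<Omega> v2 + L2_of \<Omega> R3 \<bullet> L2_of \<Omega> v3"
proof -
  have L: "R1 \<in> L2_space \<Omega>" "R2 \<in> L2_space \<Omega>" "R3 \<in> L2_space \<Omega>"
    "v1 \<in> L2_space \<Omega>" "v2 \<in> L2_space \<Omega>" "v3 \<in> L2_space \<Omega>"
    using R v by auto
  show ?thesis
    using L2_integrable_inner[OF L(1,4)] L2_integrable_inner[OF L(2,5)] L2_integrable_inner[OF L(3,6)]
    by (simp add: inner_L2_of[OF \<Omega> L(1,4)] inner_L2_of[OF \<Omega> L(2,5)] inner_L2_of[OF \<Omega> L(3,6)])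
qed

text \<open>A Poincare constant in the sense of the definition may fail to be positive, and M may be
  0, whereas \<open>\<mu> = M / C^2\<close> has to be defined and positive. Both bounds may be
  enlarged as long as the resulting inequality stays strict.\<close>

lemma smallness_condition:
  fixes C K M \<epsilon> :: real
  assumes KM: "0 \<le> K" "0 \<le> M" and \<epsilon>: "0 < \<epsilon>"
    and small: "K + sqrt 2 * C * inverse \<epsilon> * M < sqrt 2 / (1 + C\<^sup>2)"
  obtains C' M' where "0 < C'" "C \<le> C'" "0 < M'" "M \<le> M'" "K * C' + 2 * M' * C'\<^sup>2 / \<epsilon> < 1"
proof (cases "C \<le> 0")
  case True
  \<comment> \<open>For \<open>\<delta> \<le> 1\<close> the left side with \<delta> and
    \<open>M + 1\<close> is at most \<open>B * \<delta>\<close>, because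
    \<open>\<delta>^2 \<le> \<delta>\<close>; the choice \<open>1 / (2 + B)\<close> pushes this
    below 1.\<close>
  define B where "B = K + 2 * (M + 1) / \<epsilon>"
  define \<delta> where "\<delta> = 1 / (2 + B)"
  have B: "B \<ge> 0" using KM \<epsilon> by (simp add: B_def)
  have \<delta>: "0 < \<delta>" "\<delta> \<le> 1" "B * \<delta> < 1" using B by (auto simp: \<delta>_def field_simps)
  have "K * \<delta> + 2 * (M + 1) * \<delta>\<^sup>2 / \<epsilon> \<le> K * \<delta> + 2 * (M + 1) * \<delta> / \<epsilon>"
    using \<delta> KM \<epsilon> by (intro add_left_mono divide_right_mono mult_left_mono) (auto simp: power2_eq_square mult_le_one mult_left_le)
  also have "\<dots> = B * \<delta>" by (simp add: B_def algebra_simps)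
  also note \<delta>(3)
  finally show thesis using that[of \<delta> "M + 1"] \<delta>(1) True KM(2) by simp
next
  case False
  then have C: "C > 0" by simp
  \<comment> \<open>The hypothesis is multiplied by \<open>2 * C * sqrt 2\<close>, and
    \<open>2 * C \<le> 1 + C^2\<close> removes the denominator. After halving, K still carries a
    factor \<open>sqrt 2\<close>, which is dropped.\<close>
  have "2 * C \<le> 1 + C\<^sup>2" using zero_le_power2[of "C - 1"] unfolding power2_diff by simp
  moreover have "1 + C\<^sup>2 > 0" by (simp add: add_pos_nonneg)
  ultimately have "2 * C / (1 + C\<^sup>2) \<le> 1" by simp
  then have "2 * C / (1 + C\<^sup>2) * sqrt 2 \<le> 1 * sqrt 2" by (rule mult_right_mono) simp
  then have "2 * C * (sqrt 2 / (1 + C\<^sup>2)) \<le> sqrt 2" by simp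
  moreover have "2 * C * (K + sqrt 2 * C * inverse \<epsilon> * M) < 2 * C * (sqrt 2 / (1 + C\<^sup>2))"
    by (rule mult_strict_left_mono[OF small]) (use C in simp)
  ultimately have "2 * C * (K + sqrt 2 * C * inverse \<epsilon> * M) < sqrt 2" by linarith
  then have "sqrt 2 * (2 * C * (K + sqrt 2 * C * inverse \<epsilon> * M)) < sqrt 2 * sqrt 2"
    by (intro mult_strict_left_mono) auto
  then have lt: "sqrt 2 * (K * C) + 2 * M * C\<^sup>2 / \<epsilon> < 1"
    by (simp add: algebra_simps power2_eq_square divide_inverse)
  have "1 * (K * C) \<le> sqrt 2 * (K * C)" using KM(1) C by (intro mult_right_mono) auto
  with lt have lt': "K * C + 2 * M * C\<^sup>2 / \<epsilon> < 1" by simp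
  \<comment> \<open>Enlarging M by \<eta> uses up exactly half of the slack in
    \<open>lt'\<close>.\<close>
  define \<eta> where "\<eta> = \<epsilon> * (1 - (K * C + 2 * M * C\<^sup>2 / \<epsilon>)) / (4 * C\<^sup>2)"
  have \<eta>: "\<eta> > 0" using lt' C \<epsilon> by (simp add: \<eta>_def)
  have "2 * \<eta> * C\<^sup>2 / \<epsilon> = (1 - (K * C + 2 * M * C\<^sup>2 / \<epsilon>)) / 2"
    using C \<epsilon> by (simp add: \<eta>_def)
  then have "K * C + 2 * (M + \<eta>) * C\<^sup>2 / \<epsilon> < 1"
    using lt' by (simp add: distrib_left distrib_right add_divide_distrib)
  then show thesis using that[of C "M + \<eta>"] C \<eta> KM(2) by simp
qed

theorem lemma1:
  fixes \<Omega> :: "(real ^ 2) set"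
    and \<epsilon> C\<^sub>p :: real
    and f g R :: "(real ^ 2) fun3"
    and p n \<psi> :: "real ^ 2 \<Rightarrow> real"
  assumes "bounded_lipschitz_domain \<Omega>"
    and "0 < \<epsilon>" and "\<epsilon> \<le> 1"
    and "f \<in> cube (L2_space \<Omega>)"
    and "g \<in> cube (H1 \<Omega>)"
    and "PNP_weak_solution \<Omega> \<epsilon> f g (p, n, \<psi>)"
    and "p \<in> Linf_space \<Omega>" and "n \<in> Linf_space \<Omega>" and "\<psi> \<in> W1inf \<Omega>"
    and "poincare_constant \<Omega> C\<^sub>p"
    and "Linf_norm \<Omega> (wgrad \<Omega> \<psi>)
           + sqrt 2 * C\<^sub>p * inverse \<epsilon> * max (Linf_norm \<Omega> p) (Linf_norm \<Omega> n)
         < sqrt 2 / (1 + C\<^sub>p\<^sup>2)"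
    and "R \<in> cube (L2_space \<Omega>)"
  shows "\<exists>\<phi>\<in>cube (H10 \<Omega>).
           (\<forall>v\<in>cube (H10 \<Omega>). PNP_DF \<Omega> \<epsilon> (p, n, \<psi>) \<phi> v = L2_pairing \<Omega> R v) \<and>
           (\<forall>\<phi>'\<in>cube (H10 \<Omega>).
              (\<forall>v\<in>cube (H10 \<Omega>). PNP_DF \<Omega> \<epsilon> (p, n, \<psi>) \<phi>' v = L2_pairing \<Omega> R v) \<longrightarrow>
              AE_equal3 \<Omega> \<phi>' \<phi>)"
proof -
  have \<Omega>: "open \<Omega>" "\<Omega> \<noteq> {}" using assms(1) by (auto simp: bounded_lipschitz_domain_def)
  then have \<Omega>l: "\<Omega> \<in> sets lebesgue" by auto
  note p = assms(7) and n = assms(8)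
  have w: "wgrad \<Omega> \<psi> \<in> Linf_space \<Omega>" by (rule W1inf_wgrad[OF \<Omega>(1) assms(9)])
  obtain R1 R2 R3 where R: "R = (R1, R2, R3)" "(R1, R2, R3) \<in> cube (L2_space \<Omega>)"
    using assms(12) by (cases R) auto
  define K where "K = Linf_norm \<Omega> (wgrad \<Omega> \<psi>)"
  have K0: "0 \<le> K" using Linf_norm_nonneg[OF \<Omega> w] by (simp add: K_def)
  have "0 \<le> max (Linf_norm \<Omega> p) (Linf_norm \<Omega> n)"
    using Linf_norm_nonneg[OF \<Omega> p] by (simp add: le_max_iff_disj)
  from smallness_condition[OF K0 this assms(2,11)[folded K_def]]
  obtain C M where CM: "0 < C" "C\<^sub>p \<le> C" "0 < M" "max (Linf_norm \<Omega> p) (Linf_norm \<Omega> n) \<le> M"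
    "K * C + 2 * M * C\<^sup>2 / \<epsilon> < 1" .
  let ?P = "L2_map \<Omega> (\<lambda>x y. p x *\<^sub>R y) :: (real ^ 2, real ^ 2) L2 \<Rightarrow> _"
  let ?N = "L2_map \<Omega> (\<lambda>x y. n x *\<^sub>R y) :: (real ^ 2, real ^ 2) L2 \<Rightarrow> _"
  let ?S = "L2_map \<Omega> (\<lambda>x c. c *\<^sub>R wgrad \<Omega> \<psi> x)"
  have maps: "bounded_fibre_map \<Omega> (\<lambda>x (y::real ^ 2). p x *\<^sub>R y) M"
    "bounded_fibre_map \<Omega> (\<lambda>x (y::real ^ 2). n x *\<^sub>R y) M"
    "bounded_fibre_map \<Omega> (\<lambda>x c. c *\<^sub>R wgrad \<Omega> \<psi> x) K"
    using CM(4) by (auto intro!: bounded_fibre_map_scaleR[OF \<Omega>l p] bounded_fibre_map_scaleR[OF \<Omega>l n]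
      bounded_fibre_map_scaleR_left[OF \<Omega>l w] simp: K_def)
  have M0: "0 \<le> M" using CM(3) by simp
  let ?J = "H1_embed \<Omega>"
  define H where "H = ?J ` H10 \<Omega>"
  note H = subspace_H1_embed_H10[OF \<Omega>(1), folded H_def]
  have H10_H1: "v \<in> H1 \<Omega>" if "v \<in> H10 \<Omega>" for v using that by (simp add: H10_def)
  have poincare: "norm u \<le> C * norm h" if "(u, h) \<in> H" for u h
  proof -
    obtain v where v: "v \<in> H10 \<Omega>" "u = L2_of \<Omega> v" "h = L2_of \<Omega> (wgrad \<Omega> v)"
      using \<open>(u, h) \<in> H\<close> by (auto simp: H_def H1_embed_def)
    note V = H1_wgrad[OF \<Omega>(1) H10_H1[OF v(1)]]
    have "norm u \<le> C\<^sub>p * norm h"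
      using assms(10) v(1) by (simp add: poincare_constant_def v(2,3) norm_L2_of[OF \<Omega>l V(1)] norm_L2_of[OF \<Omega>l V(3)])
    also have "\<dots> \<le> C * norm h" using CM(2) by (intro mult_right_mono) auto
    finally show ?thesis .
  qed
  \<comment> \<open>The quantification runs over abstract pairs in H, the shape in which the Hilbert
    space argument delivers the solution; \<open>solves_iff\<close> translates it into test
    functions from \<open>H10\<close>.\<close>
  define solves where "solves X \<longleftrightarrow> (\<forall>v1 h1 v2 h2 v3 h3. (v1, h1) \<in> H \<and> (v2, h2) \<in> H \<and> (v3, h3) \<in> H \<longrightarrow>
    linearised_form ?P ?N ?S \<epsilon> X ((v1, h1), (v2, h2), (v3, h3))
      = L2_of \<Omega> R1 \<bullet> v1 + L2_of \<Omega> R2 \<bullet> v2 + L2_of \<Omega> R3 \<bullet> v3)" for X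
  have ex1: "\<exists>!X. X \<in> H \<times> H \<times> H \<and> solves X"
    unfolding solves_def
    by (rule linearised_form_unique_solution[OF H
          L2_map_bounded_linear[OF maps(1) M0] L2_map_bounded_linear[OF maps(2) M0] L2_map_bounded_linear[OF maps(3) K0]
          L2_map_norm[OF maps(1) M0] L2_map_norm[OF maps(2) M0] L2_map_norm[OF maps(3) K0]
          CM(3) K0 CM(1) assms(2) poincare CM(5)])
  have solves_iff: "solves (?J \<phi>1, ?J \<phi>2, ?J \<phi>3) \<longleftrightarrow>
      (\<forall>v\<in>cube (H10 \<Omega>). PNP_DF \<Omega> \<epsilon> (p, n, \<psi>) (\<phi>1, \<phi>2, \<phi>3) v = L2_pairing \<Omega> R v)" (is "_ \<longleftrightarrow> ?weak")
    if \<phi>: "\<phi>1 \<in> H10 \<Omega>" "\<phi>2 \<in> H10 \<Omega>" "\<phi>3 \<in> H10 \<Omega>" for \<phi>1 \<phi>2 \<phi>3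
  proof -
    have eq: "PNP_DF \<Omega> \<epsilon> (p, n, \<psi>) (\<phi>1, \<phi>2, \<phi>3) (v1, v2, v3)
        = linearised_form ?P ?N ?S \<epsilon> (?J \<phi>1, ?J \<phi>2, ?J \<phi>3) (?J v1, ?J v2, ?J v3)"
      "L2_pairing \<Omega> R (v1, v2, v3) = L2_of \<Omega> R1 \<bullet> L2_of \<Omega> v1 + L2_of \<Omega> R2 \<bullet> L2_of \<Omega> v2 + L2_of \<Omega> R3 \<bullet> L2_of \<Omega> v3"
      if "v1 \<in> H10 \<Omega>" "v2 \<in> H10 \<Omega>" "v3 \<in> H10 \<Omega>" for v1 v2 v3
    proof -
      show "PNP_DF \<Omega> \<epsilon> (p, n, \<psi>) (\<phi>1, \<phi>2, \<phi>3) (v1, v2, v3)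
        = linearised_form ?P ?N ?S \<epsilon> (?J \<phi>1, ?J \<phi>2, ?J \<phi>3) (?J v1, ?J v2, ?J v3)"
        by (intro PNP_DF_eq_form \<Omega>(1) p n w H10_H1 \<phi> that)
      show "L2_pairing \<Omega> R (v1, v2, v3) = L2_of \<Omega> R1 \<bullet> L2_of \<Omega> v1 + L2_of \<Omega> R2 \<bullet> L2_of \<Omega> v2 + L2_of \<Omega> R3 \<bullet> L2_of \<Omega> v3"
        unfolding R(1) using that H1_wgrad(1)[OF \<Omega>(1) H10_H1] by (intro L2_pairing_eq[OF \<Omega>l R(2)]) simp
    qed
    have "solves (?J \<phi>1, ?J \<phi>2, ?J \<phi>3) \<longleftrightarrow> (\<forall>v1\<in>H10 \<Omega>. \<forall>v2\<in>H10 \<Omega>. \<forall>v3\<in>H10 \<Omega>.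
        linearised_form ?P ?N ?S \<epsilon> (?J \<phi>1, ?J \<phi>2, ?J \<phi>3) (?J v1, ?J v2, ?J v3)
          = L2_of \<Omega> R1 \<bullet> L2_of \<Omega> v1 + L2_of \<Omega> R2 \<bullet> L2_of \<Omega> v2 + L2_of \<Omega> R3 \<bullet> L2_of \<Omega> v3)" (is "_ \<longleftrightarrow> ?B")
    proof
      assume s: "solves (?J \<phi>1, ?J \<phi>2, ?J \<phi>3)"
      show ?B
      proof (intro ballI)
        fix v1 v2 v3 assume v: "v1 \<in> H10 \<Omega>" "v2 \<in> H10 \<Omega>" "v3 \<in> H10 \<Omega>"
        have "(L2_of \<Omega> v, L2_of \<Omega> (wgrad \<Omega> v)) \<in> H" if "v \<in> H10 \<Omega>" for v
          unfolding H_def using imageI[OF that, of ?J] by (simp only: H1_embed_def)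
        with v show "linearised_form ?P ?N ?S \<epsilon> (?J \<phi>1, ?J \<phi>2, ?J \<phi>3) (?J v1, ?J v2, ?J v3)
            = L2_of \<Omega> R1 \<bullet> L2_of \<Omega> v1 + L2_of \<Omega> R2 \<bullet> L2_of \<Omega> v2 + L2_of \<Omega> R3 \<bullet> L2_of \<Omega> v3"
          unfolding H1_embed_def[of \<Omega> v1] H1_embed_def[of \<Omega> v2] H1_embed_def[of \<Omega> v3]
          by (intro s[unfolded solves_def, rule_format] conjI)
      qed
    next
      assume B: ?B
      show "solves (?J \<phi>1, ?J \<phi>2, ?J \<phi>3)"
        unfolding solves_def
      proof (intro allI impI, elim conjE)
        fix v1 h1 v2 h2 v3 h3 assume "(v1, h1) \<in> H" "(v2, h2) \<in> H" "(v3, h3) \<in> H"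
        then obtain w1 w2 w3 where w: "w1 \<in> H10 \<Omega>" "w2 \<in> H10 \<Omega>" "w3 \<in> H10 \<Omega>"
          and e: "(v1, h1) = ?J w1" "(v2, h2) = ?J w2" "(v3, h3) = ?J w3"
          unfolding H_def by (elim imageE)
        have u: "v1 = L2_of \<Omega> w1" "v2 = L2_of \<Omega> w2" "v3 = L2_of \<Omega> w3"
          using e by (simp_all only: H1_embed_def prod.inject)
        show "linearised_form ?P ?N ?S \<epsilon> (?J \<phi>1, ?J \<phi>2, ?J \<phi>3) ((v1, h1), (v2, h2), (v3, h3))
            = L2_of \<Omega> R1 \<bullet> v1 + L2_of \<Omega> R2 \<bullet> v2 + L2_of \<Omega> R3 \<bullet> v3"
          unfolding e unfolding u by (rule B[rule_format, OF w])
      qed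
    qed
    also have "\<dots> \<longleftrightarrow> ?weak" by (auto simp: eq simp del: PNP_DF.simps L2_pairing.simps linearised_form.simps)
    finally show ?thesis .
  qed
  from ex1 obtain X where X: "X \<in> H \<times> H \<times> H \<and> solves X"
    and uniq: "\<forall>Y. Y \<in> H \<times> H \<times> H \<and> solves Y \<longrightarrow> Y = X"
    by (rule ex1E)
  obtain \<phi>1 \<phi>2 \<phi>3 where X_eq: "X = (?J \<phi>1, ?J \<phi>2, ?J \<phi>3)"
    and \<phi>: "\<phi>1 \<in> H10 \<Omega>" "\<phi>2 \<in> H10 \<Omega>" "\<phi>3 \<in> H10 \<Omega>"
    using X unfolding H_def by blast
  show ?thesis
  proof (intro bexI[of _ "(\<phi>1, \<phi>2, \<phi>3)"] conjI ballI impI)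
    show "(\<phi>1, \<phi>2, \<phi>3) \<in> cube (H10 \<Omega>)" using \<phi> by simp
    show "PNP_DF \<Omega> \<epsilon> (p, n, \<psi>) (\<phi>1, \<phi>2, \<phi>3) v = L2_pairing \<Omega> R v" if "v \<in> cube (H10 \<Omega>)" for v
      using solves_iff[OF \<phi>] X that unfolding X_eq by blast
    fix \<phi>' assume \<phi>': "\<phi>' \<in> cube (H10 \<Omega>)"
      and sol: "\<forall>v\<in>cube (H10 \<Omega>). PNP_DF \<Omega> \<epsilon> (p, n, \<psi>) \<phi>' v = L2_pairing \<Omega> R v"
    obtain \<eta>1 \<eta>2 \<eta>3 where \<eta>: "\<phi>' = (\<eta>1, \<eta>2, \<eta>3)" "\<eta>1 \<in> H10 \<Omega>" "\<eta>2 \<in> H10 \<Omega>" "\<eta>3 \<in> H10 \<Omega>"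
      using \<phi>' by auto
    have "(?J \<eta>1, ?J \<eta>2, ?J \<eta>3) = X"
    proof (rule uniq[rule_format], rule conjI)
      show "(?J \<eta>1, ?J \<eta>2, ?J \<eta>3) \<in> H \<times> H \<times> H" unfolding H_def using \<eta>(2-4) by blast
      show "solves (?J \<eta>1, ?J \<eta>2, ?J \<eta>3)"
        using solves_iff[OF \<eta>(2-4)] sol unfolding \<eta>(1) by (rule iffD2)
    qed
    \<comment> \<open>The first components of the embedded pairs suffice. Equality of their classes
      is equality almost everywhere on \<Omega>, which is the sense of uniqueness in
      \<open>AE_equal3\<close>.\<close>
    then have "L2_of \<Omega> \<eta>1 = L2_of \<Omega> \<phi>1" "L2_of \<Omega> \<eta>2 = L2_of \<Omega> \<phi>2" "L2_of \<Omega> \<eta>3 = L2_of \<Omega> \<phi>3"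
      by (simp_all add: X_eq H1_embed_def)
    then have "AE x in lebesgue_on \<Omega>. \<eta>1 x = \<phi>1 x" "AE x in lebesgue_on \<Omega>. \<eta>2 x = \<phi>2 x"
      "AE x in lebesgue_on \<Omega>. \<eta>3 x = \<phi>3 x"
      using L2_of_eq_iff[OF \<Omega>l] H1_wgrad(1)[OF \<Omega>(1) H10_H1] \<phi> \<eta>(2-4) by blast+
    then show "AE_equal3 \<Omega> \<phi>' (\<phi>1, \<phi>2, \<phi>3)"
      unfolding \<eta>(1) AE_equal3.simps by eventually_elim simp
  qed
qed

end
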